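(* Let $(A,B)$ be a commuting dilation pair in $\mathrm{GL}_d(\mathbb{R})$ with $A=A^*$, $B=B^*$, and let $(\phi,\mathfrak{V})$ be a biscaled multiresolution analysis in $L^2(\mathbb{R}^d)$ with respect to $(A,B)$. If $\hat\phi(\xi)$ is nonvanishing almost everywhere, then the marginal filter functions of $\phi$ satisfy $$m_\phi^A(B\xi)\,m_\phi^B(\xi)=m_\phi^A(\xi)\,m_\phi^B(A\xi)\quad\text{for almost every }\xi\in\mathbb{R}^d.$$
   Context: The Fourier transform on $L^2(\mathbb{R}^d)$ is the unitary extension of $\hat f(\xi)=(2\pi)^{-d/2}\int_{\mathbb{R}^d}e^{-i\langle\xi,x\rangle}f(x)\,dx$. A dilation matrix is an integer matrix all of whose eigenvalues have absolute value greater than $1$. A commuting dilation pair $(A,B)$ in $\mathrm{GL}_d(\mathbb{R})$ is a pair which, after a suitable permutation of the standard basis, has the form $A=\begin{bmatrix}A'&0\\0&I_{d-p}\end{bmatrix}$, $B=\begin{bmatrix}I_{d-q}&0\\0&B'\end{bmatrix}$ with $p+q=d$ and $A'\in\mathrm{GL}_p(\mathbb{R})$, $B'\in\mathrm{GL}_q(\mathbb{R})$ dilation matrices. For $M\in\mathrm{GL}_d(\mathbb{R})$, $(D_Mf)(x)=|\det M|^{1/2}f(Mx)$. A biscaled multiresolution analysis (BMRA) with respect to $(A,B)$ is a pair $(\phi,\mathfrak{V})$ where $\phi\in L^2(\mathbb{R}^d)$ and $\mathfrak{V}=\{V_{i,j}:(i,j)\in\mathbb{Z}^2\}$ is a family of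 closed subspaces of $L^2(\mathbb{R}^d)$ such that: (i) $V_{i,j}\subseteq V_{l,m}$ for $i\le l$, $j\le m$; (ii) $D_A^iD_B^jV_{0,0}=V_{i,j}$ for all $i,j$; (iii) $\bigcap_{(i,j)\in\mathbb{Z}^2}V_{i,j}=\{0\}$; (iv) $\overline{\bigcup_{(i,j)\in\mathbb{Z}^2}V_{i,j}}=L^2(\mathbb{R}^d)$; (v) the orthogonal projections $P_{i,j}$ onto $V_{i,j}$ commute pairwise; (vi) $\{\phi(x-k):k\in\mathbb{Z}^d\}$ is an orthonormal basis of $V_{0,0}$. Marginal filters: for $T\in\{A,B\}$, $\phi\circ T^{-1}\in V_{0,0}$ has an expansion $\phi(T^{-1}x)=\sum_{k\in\mathbb{Z}^d}c(k)\phi(x-k)$ with $(c(k))$ square summable, and $m^T_\phi(\xi)=\frac1{|\det T|}\sum_{k\in\mathbb{Z}^d}c(k)e^{-i\langle\xi,k\rangle}$, a $2\pi\mathbb{Z}^d$-periodic function. *)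

theory Defs
  imports "Jordan_Normal_Form.Char_Poly" "HOL-Analysis.Analysis"
begin

no_notation vec_index (infixl "$" 100)
no_notation scalar_prod (infix "\<bullet>" 70)

section \<open>The Hilbert space of square integrable functions\<close>

text \<open>Elements of \<open>L\<^sup>2\<close> are represented by measurable functions. Two representatives of the
  same element agree almost everywhere, and a subspace of \<open>L\<^sup>2\<close> is represented by the set of all
  representatives of its elements. On \<open>real^'n\<close> the representatives are Borel functions, which loses
  nothing because every Lebesgue measurable function is almost everywhere equal to a Borel one.\<close>

definition L2 :: "'a measure \<Rightarrow> ('a \<Rightarrow> complex) set" where
  "L2 M = {f \<in> borel_measurable M. integrable M (\<lambda>x. (cmod (f x))\<^sup>2)}"

definition L2_inner :: "'a measure \<Rightarrow> ('a \<Rightarrow> complex) \<Rightarrow> ('a \<Rightarrow> complex) \<Rightarrow> complex" where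
  "L2_inner M f g = (LINT x|M. f x * cnj (g x))"

definition L2_norm :: "'a measure \<Rightarrow> ('a \<Rightarrow> complex) \<Rightarrow> real" where
  "L2_norm M f = sqrt (LINT x|M. (cmod (f x))\<^sup>2)"

text \<open>The closure of any set contains, with a function, everything equal to it almost everywhere.\<close>

definition L2_closure :: "'a measure \<Rightarrow> ('a \<Rightarrow> complex) set \<Rightarrow> ('a \<Rightarrow> complex) set" where
  "L2_closure M S = {f \<in> L2 M. \<forall>\<epsilon>>0. \<exists>g \<in> S \<inter> L2 M. L2_norm M (\<lambda>x. f x - g x) < \<epsilon>}"

definition L2_closed_subspace :: "'a measure \<Rightarrow> ('a \<Rightarrow> complex) set \<Rightarrow> bool" where
  "L2_closed_subspace M V \<longleftrightarrow>
     V \<subseteq> L2 M \<and> (\<lambda>x. 0) \<in> V \<and>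
     (\<forall>f\<in>V. \<forall>g\<in>V. (\<lambda>x. f x + g x) \<in> V) \<and>
     (\<forall>f\<in>V. \<forall>a. (\<lambda>x. a * f x) \<in> V) \<and>
     L2_closure M V = V"

text \<open>The orthogonal projection onto a closed subspace, determined up to a null set.\<close>

definition L2_proj ::
    "'a measure \<Rightarrow> ('a \<Rightarrow> complex) set \<Rightarrow> ('a \<Rightarrow> complex) \<Rightarrow> ('a \<Rightarrow> complex)" where
  "L2_proj M V f = (SOME g. g \<in> V \<and> (\<forall>h\<in>V. L2_inner M (\<lambda>x. f x - g x) h = 0))"

definition lin_span :: "('k \<Rightarrow> 'a \<Rightarrow> complex) \<Rightarrow> ('a \<Rightarrow> complex) set" where
  "lin_span e = {(\<lambda>x. \<Sum>k\<in>K. c k * e k x) | K c. finite K}"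

definition L2_orthonormal_basis ::
    "'a measure \<Rightarrow> ('a \<Rightarrow> complex) set \<Rightarrow> ('k \<Rightarrow> 'a \<Rightarrow> complex) \<Rightarrow> bool" where
  "L2_orthonormal_basis M V e \<longleftrightarrow>
     (\<forall>k. e k \<in> L2 M) \<and>
     (\<forall>k l. L2_inner M (e k) (e l) = (if k = l then 1 else 0)) \<and>
     L2_closure M (lin_span e) = V"

text \<open>Unconditional convergence of a series in the norm of \<open>L\<^sup>2\<close>.\<close>

definition L2_has_sum ::
    "'a measure \<Rightarrow> ('k \<Rightarrow> 'a \<Rightarrow> complex) \<Rightarrow> ('a \<Rightarrow> complex) \<Rightarrow> bool" where
  "L2_has_sum M f s \<longleftrightarrow>
     (\<forall>k. f k \<in> L2 M) \<and> s \<in> L2 M \<and>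
     ((\<lambda>K. L2_norm M (\<lambda>x. (\<Sum>k\<in>K. f k x) - s x)) \<longlongrightarrow> 0) (finite_subsets_at_top UNIV)"

definition L2_unitary ::
    "'a measure \<Rightarrow> (('a \<Rightarrow> complex) \<Rightarrow> ('a \<Rightarrow> complex)) \<Rightarrow> bool" where
  "L2_unitary M U \<longleftrightarrow>
     (\<forall>f\<in>L2 M. U f \<in> L2 M) \<and>
     (\<forall>f\<in>L2 M. \<forall>g\<in>L2 M. \<forall>a b.
        AE x in M. U (\<lambda>y. a * f y + b * g y) x = a * U f x + b * U g x) \<and>
     (\<forall>f\<in>L2 M. \<forall>g\<in>L2 M. L2_inner M (U f) (U g) = L2_inner M f g) \<and>
     (\<forall>g\<in>L2 M. \<exists>f\<in>L2 M. AE x in M. U f x = g x)"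

section \<open>The Fourier transform\<close>

definition fourier_integral :: "(real^'n \<Rightarrow> complex) \<Rightarrow> (real^'n \<Rightarrow> complex)" where
  "fourier_integral f \<xi> =
     complex_of_real ((2 * pi) powr (- (real CARD('n) / 2))) *
     (LINT x|lborel. exp (- \<i> * complex_of_real (\<xi> \<bullet> x)) * f x)"

text \<open>The unitary extension is unique up to null sets, since \<open>L\<^sup>1 \<inter> L\<^sup>2\<close> is dense.\<close>

definition L2_fourier :: "(real^'n \<Rightarrow> complex) \<Rightarrow> (real^'n \<Rightarrow> complex)" where
  "L2_fourier = (SOME U. L2_unitary lborel U \<and>
     (\<forall>f\<in>L2 lborel. integrable lborel f \<longrightarrow> (AE \<xi> in lborel. U f \<xi> = fourier_integral f \<xi>)))"

section \<open>Commuting dilation pairs\<close>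

definition dilation_matrix :: "real Matrix.mat \<Rightarrow> bool" where
  "dilation_matrix M \<longleftrightarrow> square_mat M \<and> elements_mat M \<subseteq> \<int> \<and>
     (\<forall>\<mu>. eigenvalue (map_mat complex_of_real M) \<mu> \<longrightarrow> cmod \<mu> > 1)"

text \<open>The matrix of \<open>M\<close> with respect to the standard basis listed in the order
  \<open>\<sigma> 0, \<sigma> 1, \<dots>\<close>.\<close>

definition reindexed_mat :: "(nat \<Rightarrow> 'n) \<Rightarrow> real^'n^'n \<Rightarrow> real Matrix.mat" where
  "reindexed_mat \<sigma> M = Matrix.mat CARD('n) CARD('n) (\<lambda>(r, s). M $ \<sigma> r $ \<sigma> s)"

definition commuting_dilation_pair :: "real^'n^'n \<Rightarrow> real^'n^'n \<Rightarrow> bool" where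
  "commuting_dilation_pair A B \<longleftrightarrow>
     (\<exists>\<sigma> p q A' B'.
        bij_betw \<sigma> {..<CARD('n)} UNIV \<and> p + q = CARD('n) \<and>
        A' \<in> carrier_mat p p \<and> invertible_mat A' \<and> dilation_matrix A' \<and>
        B' \<in> carrier_mat q q \<and> invertible_mat B' \<and> dilation_matrix B' \<and>
        reindexed_mat \<sigma> A = four_block_mat A' (0\<^sub>m p q) (0\<^sub>m q p) (1\<^sub>m q) \<and>
        reindexed_mat \<sigma> B = four_block_mat (1\<^sub>m p) (0\<^sub>m p q) (0\<^sub>m q p) B')"

section \<open>Biscaled multiresolution analyses\<close>

definition dilation :: "real^'n^'n \<Rightarrow> (real^'n \<Rightarrow> complex) \<Rightarrow> (real^'n \<Rightarrow> complex)" where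
  "dilation M f = (\<lambda>x. complex_of_real (sqrt \<bar>Determinants.det M\<bar>) * f (M *v x))"

definition op_zpow :: "('a \<Rightarrow> 'a) \<Rightarrow> int \<Rightarrow> 'a \<Rightarrow> 'a" where
  "op_zpow T i = (if i \<ge> 0 then T ^^ nat i else (inv_into UNIV T) ^^ nat (- i))"

definition lattice_pt :: "int^'n \<Rightarrow> real^'n" where
  "lattice_pt k = (\<chi> i. real_of_int (k $ i))"

definition bmra ::
    "real^'n^'n \<Rightarrow> real^'n^'n \<Rightarrow> (real^'n \<Rightarrow> complex) \<Rightarrow>
     (int \<Rightarrow> int \<Rightarrow> (real^'n \<Rightarrow> complex) set) \<Rightarrow> bool" where
  "bmra A B \<phi> V \<longleftrightarrow>
     \<phi> \<in> L2 lborel \<and>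
     (\<forall>i j. L2_closed_subspace lborel (V i j)) \<and>
     (\<forall>i j l m. i \<le> l \<longrightarrow> j \<le> m \<longrightarrow> V i j \<subseteq> V l m) \<and>
     (\<forall>i j. (op_zpow (dilation A) i \<circ> op_zpow (dilation B) j) ` V 0 0 = V i j) \<and>
     (\<Inter>i j. V i j) = {f \<in> L2 lborel. AE x in lborel. f x = 0} \<and>
     L2_closure lborel (\<Union>i j. V i j) = L2 lborel \<and>
     (\<forall>i j l m. \<forall>f\<in>L2 lborel. AE x in lborel.
        L2_proj lborel (V i j) (L2_proj lborel (V l m) f) x =
        L2_proj lborel (V l m) (L2_proj lborel (V i j) f) x) \<and>
     L2_orthonormal_basis lborel (V 0 0) (\<lambda>(k::int^'n) x. \<phi> (x - lattice_pt k))"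

section \<open>Marginal filters\<close>

definition filter_coeff :: "real^'n^'n \<Rightarrow> (real^'n \<Rightarrow> complex) \<Rightarrow> int^'n \<Rightarrow> complex" where
  "filter_coeff T \<phi> = (SOME c. (\<lambda>k. (cmod (c k))\<^sup>2) summable_on UNIV \<and>
     L2_has_sum lborel (\<lambda>k x. c k * \<phi> (x - lattice_pt k)) (\<lambda>x. \<phi> (matrix_inv T *v x)))"

text \<open>For square summable coefficients the trigonometric series converges in \<open>L\<^sup>2\<close> of a period
  cell; its sum is extended periodically and is determined up to a null set.\<close>

definition period_cell :: "(real^'n) measure" where
  "period_cell = restrict_space lborel (cbox (\<chi> i. - pi) (\<chi> i. pi))"

definition marginal_filter :: "real^'n^'n \<Rightarrow> (real^'n \<Rightarrow> complex) \<Rightarrow> (real^'n \<Rightarrow> complex)" where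
  "marginal_filter T \<phi> = (SOME m.
     m \<in> borel_measurable borel \<and>
     (\<forall>\<xi> k. m (\<xi> + (2 * pi) *\<^sub>R lattice_pt k) = m \<xi>) \<and>
     L2_has_sum period_cell
       (\<lambda>k \<xi>. complex_of_real (1 / \<bar>Determinants.det T\<bar>) * filter_coeff T \<phi> k *
               exp (- \<i> * complex_of_real (\<xi> \<bullet> lattice_pt k))) m)"

end

theory Submission
  imports Defs
begin

text \<open>Expand \<open>\<phi> (A\<inverse> B\<inverse> x)\<close> in the orthonormal basis \<open>\<phi> (x - n)\<close> in two ways, applying first the
  refinement equation of \<open>A\<close> or first that of \<open>B\<close>. Comparison of coefficients gives
  \<open>\<Sum>k. c\<^sub>A k * c\<^sub>B (n - B k) = \<Sum>k. c\<^sub>B k * c\<^sub>A (n - A k)\<close> for every \<open>n\<close>. Up to a common factor, the two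
  sides are the Fourier coefficients of the integrable periodic functions \<open>m\<^sub>A (B \<xi>) * m\<^sub>B \<xi>\<close> and
  \<open>m\<^sub>A \<xi> * m\<^sub>B (A \<xi>)\<close>, and an integrable function on the torus is determined by its Fourier
  coefficients.\<close>

section \<open>Square integrable functions\<close>

text \<open>Each filter is only square integrable on the cell, so the two products are merely
  integrable; this is why uniqueness is proved for integrable functions instead of being read off
  from Parseval's identity. Two series are never multiplied out: composition with a matrix is
  bounded on square integrable functions, so one series is composed termwise and then paired with
  one fixed function, and the other series enters only through its coefficients. Symmetry of B turns
  the character of frequency k, evaluated at B \<xi>, into the character of frequency B k, and
  integrality keeps B k in the lattice. The same index n - B k therefore appears for functions of x
  and for functions of \<xi>. Commutation of A and B makes the two expansions describe one function.
  The common factor is (2 pi)^d / |det A det B|, where (2 pi)^d is the squared norm of a character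
  on the cell. Filters are chosen among almost everywhere equal functions, while B \<xi> leaves the
  cell; hence the existence proof must supply a representative that is Borel on the whole space and
  exactly periodic.\<close>

lemma L2_iff_nn_integral:
  "f \<in> L2 M \<longleftrightarrow> f \<in> borel_measurable M \<and> (\<integral>\<^sup>+x. ennreal ((cmod (f x))\<^sup>2) \<partial>M) < \<infinity>"
  unfolding L2_def by (auto simp: integrable_iff_bounded)

lemma L2_measurable: "f \<in> L2 M \<Longrightarrow> f \<in> borel_measurable M"
  by (simp add: L2_def)

lemma L2_square_integrable: "f \<in> L2 M \<Longrightarrow> integrable M (\<lambda>x. (cmod (f x))\<^sup>2)"
  by (simp add: L2_def)

lemma L2_cmult: assumes "f \<in> L2 M" shows "(\<lambda>x. a * f x) \<in> L2 M"
  using assms by (auto simp: L2_def norm_mult power_mult_distrib)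

lemma L2_add: assumes "f \<in> L2 M" "g \<in> L2 M" shows "(\<lambda>x. f x + g x) \<in> L2 M"
proof -
  have [measurable]: "f \<in> borel_measurable M" "g \<in> borel_measurable M"
    using assms by (auto simp: L2_def)
  have "integrable M (\<lambda>x. (cmod (f x + g x))\<^sup>2)"
  proof (rule Bochner_Integration.integrable_bound)
    show "integrable M (\<lambda>x. 2 * (cmod (f x))\<^sup>2 + 2 * (cmod (g x))\<^sup>2)"
      using assms by (intro Bochner_Integration.integrable_add integrable_mult_right) (auto simp: L2_def)
    have "(cmod (f x + g x))\<^sup>2 \<le> 2 * (cmod (f x))\<^sup>2 + 2 * (cmod (g x))\<^sup>2" for x
    proof -
      have "(cmod (f x + g x))\<^sup>2 \<le> (cmod (f x) + cmod (g x))\<^sup>2"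
        by (intro power_mono norm_triangle_ineq) auto
      also have "\<dots> \<le> 2 * (cmod (f x))\<^sup>2 + 2 * (cmod (g x))\<^sup>2"
        using zero_le_power2[of "cmod (f x) - cmod (g x)"] by (simp add: power2_eq_square algebra_simps)
      finally show ?thesis .
    qed
    then show "AE x in M. norm ((cmod (f x + g x))\<^sup>2) \<le> norm (2 * (cmod (f x))\<^sup>2 + 2 * (cmod (g x))\<^sup>2)"
      by simp
  qed measurable
  then show ?thesis by (auto simp: L2_def)
qed

lemma L2_diff: assumes "f \<in> L2 M" "g \<in> L2 M" shows "(\<lambda>x. f x - g x) \<in> L2 M"
  using L2_add[OF assms(1) L2_cmult[OF assms(2), of "-1"]] by simp

lemma L2_zero: "(\<lambda>x. 0) \<in> L2 M"
  by (simp add: L2_def)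

lemma L2_sum: assumes "\<And>k. k \<in> K \<Longrightarrow> f k \<in> L2 M" shows "(\<lambda>x. \<Sum>k\<in>K. f k x) \<in> L2 M"
  using assms by (induction K rule: infinite_finite_induct) (auto simp: L2_zero intro!: L2_add)

lemma L2_cnj: assumes "f \<in> L2 M" shows "(\<lambda>x. cnj (f x)) \<in> L2 M"
  proof -
  have "cnj \<in> borel_measurable borel"
    by (intro borel_measurable_continuous_onI continuous_intros)
  from measurable_compose[OF L2_measurable[OF assms] this] assms show ?thesis
    by (simp add: L2_def)
qed

lemma L2_mult_integrable:
  assumes "f \<in> L2 M" "g \<in> L2 M" shows "integrable M (\<lambda>x. f x * g x)"
proof -
  have [measurable]: "f \<in> borel_measurable M" "g \<in> borel_measurable M"
    using assms by (auto simp: L2_def)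
  show ?thesis
  proof (rule Bochner_Integration.integrable_bound)
    show "integrable M (\<lambda>x. (cmod (f x))\<^sup>2 + (cmod (g x))\<^sup>2)"
      using assms by (auto simp: L2_def)
    have "cmod (f x * g x) \<le> (cmod (f x))\<^sup>2 + (cmod (g x))\<^sup>2" for x
    proof -
      have "2 * (cmod (f x) * cmod (g x)) \<le> (cmod (f x))\<^sup>2 + (cmod (g x))\<^sup>2"
        using zero_le_power2[of "cmod (f x) - cmod (g x)"] by (simp add: power2_eq_square algebra_simps)
      moreover have "0 \<le> cmod (f x) * cmod (g x)" by simp
      ultimately show ?thesis unfolding norm_mult by linarith
    qed
    then show "AE x in M. norm (f x * g x) \<le> norm ((cmod (f x))\<^sup>2 + (cmod (g x))\<^sup>2)" by simp
  qed measurable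
qed

lemma L2_norm_nonneg: "0 \<le> L2_norm M f"
  by (simp add: L2_norm_def)

lemma L2_norm_square: "(L2_norm M f)\<^sup>2 = (LINT x|M. (cmod (f x))\<^sup>2)"
  by (simp add: L2_norm_def)

lemma L2_norm_minus_commute: "L2_norm M (\<lambda>x. f x - g x) = L2_norm M (\<lambda>x. g x - f x)"
  by (simp add: L2_norm_def norm_minus_commute)

text \<open>The quadratic polynomial in t given by the integral of (|f| - t |g|)^2 is nonnegative,
  which bounds its discriminant. Absolute values inside the integral give the form needed for the
  triangle inequality and for comparing the integral of |f| with the norm of f.\<close>

lemma L2_Cauchy_Schwarz_abs:
  assumes f: "f \<in> L2 M" and g: "g \<in> L2 M"
  shows "(LINT x|M. cmod (f x) * cmod (g x)) \<le> L2_norm M f * L2_norm M g"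
proof -
  let ?F = "LINT x|M. (cmod (f x))\<^sup>2" and ?G = "LINT x|M. (cmod (g x))\<^sup>2"
    and ?P = "LINT x|M. cmod (f x) * cmod (g x)"
  have iF: "integrable M (\<lambda>x. (cmod (f x))\<^sup>2)" and iG: "integrable M (\<lambda>x. (cmod (g x))\<^sup>2)"
    using f g by (auto simp: L2_def)
  have iP: "integrable M (\<lambda>x. cmod (f x) * cmod (g x))"
    using integrable_norm[OF L2_mult_integrable[OF f g]] by (simp add: norm_mult)
  have q: "0 \<le> ?F - 2 * t * ?P + t\<^sup>2 * ?G" for t
  proof -
    have "0 \<le> (LINT x|M. (cmod (f x) - t * cmod (g x))\<^sup>2)" by simp
    also have "\<dots> = (LINT x|M. (cmod (f x))\<^sup>2 - (2 * t) * (cmod (f x) * cmod (g x)) + t\<^sup>2 * (cmod (g x))\<^sup>2)"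
      by (intro Bochner_Integration.integral_cong) (auto simp: power2_eq_square algebra_simps)
    also have "\<dots> = ?F - 2 * t * ?P + t\<^sup>2 * ?G"
      using iF iG iP by simp
    finally show ?thesis .
  qed
  have P0: "0 \<le> ?P" by simp
  have "?P\<^sup>2 \<le> ?F * ?G"
  proof (cases "?G = 0")
    case True
    have "?P = 0"
    proof (rule ccontr)
      assume "?P \<noteq> 0"
      \<comment> \<open>With \<open>?G = 0\<close> the polynomial is affine in t, and this t gives
        it the value -1.\<close>
      with q[of "(?F + 1) / (2 * ?P)"] True show False by simp
    qed
    then show ?thesis using True by simp
  next
    case False
    then have "?G > 0" by (smt (verit) Bochner_Integration.integral_nonneg zero_le_power2)
    \<comment> \<open>The minimizer of the quadratic polynomial.\<close>
    with q[of "?P / ?G"] show ?thesis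
      by (simp add: power2_eq_square field_simps)
  qed
  then have "sqrt (?P\<^sup>2) \<le> sqrt (?F * ?G)" by (rule real_sqrt_le_mono)
  then show ?thesis using P0 by (simp add: L2_norm_def real_sqrt_mult)
qed

lemma L2_Cauchy_Schwarz:
  assumes f: "f \<in> L2 M" and g: "g \<in> L2 M"
  shows "cmod (L2_inner M f g) \<le> L2_norm M f * L2_norm M g"
proof -
  have "cmod (L2_inner M f g) \<le> (LINT x|M. cmod (f x * cnj (g x)))"
    unfolding L2_inner_def by (rule integral_norm_bound)
  also have "\<dots> = (LINT x|M. cmod (f x) * cmod (g x))" by (simp add: norm_mult)
  finally show ?thesis using L2_Cauchy_Schwarz_abs[OF f g] by linarith
qed

lemma L2_norm_triangle:
  assumes f: "f \<in> L2 M" and g: "g \<in> L2 M"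
  shows "L2_norm M (\<lambda>x. f x + g x) \<le> L2_norm M f + L2_norm M g"
proof (rule power2_le_imp_le)
  have iF: "integrable M (\<lambda>x. (cmod (f x))\<^sup>2)" and iG: "integrable M (\<lambda>x. (cmod (g x))\<^sup>2)"
    using f g by (auto simp: L2_def)
  have iP: "integrable M (\<lambda>x. cmod (f x) * cmod (g x))"
    using integrable_norm[OF L2_mult_integrable[OF f g]] by (simp add: norm_mult)
  have "(L2_norm M (\<lambda>x. f x + g x))\<^sup>2 = (LINT x|M. (cmod (f x + g x))\<^sup>2)"
    by (rule L2_norm_square)
  also have "\<dots> \<le> (LINT x|M. (cmod (f x))\<^sup>2 + 2 * (cmod (f x) * cmod (g x)) + (cmod (g x))\<^sup>2)"
  proof (rule integral_mono)
    fix x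
    have "(cmod (f x + g x))\<^sup>2 \<le> (cmod (f x) + cmod (g x))\<^sup>2"
      by (intro power_mono norm_triangle_ineq) auto
    then show "(cmod (f x + g x))\<^sup>2 \<le> (cmod (f x))\<^sup>2 + 2 * (cmod (f x) * cmod (g x)) + (cmod (g x))\<^sup>2"
      by (simp add: power2_eq_square algebra_simps)
  qed (use iF iG iP L2_add[OF f g] in \<open>auto simp: L2_def\<close>)
  also have "\<dots> = (L2_norm M f)\<^sup>2 + 2 * (LINT x|M. cmod (f x) * cmod (g x)) + (L2_norm M g)\<^sup>2"
    using iF iG iP by (simp add: L2_norm_square)
  also have "\<dots> \<le> (L2_norm M f + L2_norm M g)\<^sup>2"
    using L2_Cauchy_Schwarz_abs[OF f g] by (simp add: power2_eq_square algebra_simps)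
  finally show "(L2_norm M (\<lambda>x. f x + g x))\<^sup>2 \<le> (L2_norm M f + L2_norm M g)\<^sup>2" .
qed (simp add: L2_norm_nonneg)

lemma L2_norm_triangle_diff:
  assumes "f \<in> L2 M" "g \<in> L2 M" "h \<in> L2 M"
  shows "L2_norm M (\<lambda>x. f x - h x) \<le> L2_norm M (\<lambda>x. f x - g x) + L2_norm M (\<lambda>x. g x - h x)"
  using L2_norm_triangle[OF L2_diff[OF assms(1,2)] L2_diff[OF assms(2,3)]] by simp

lemma L2_inner_diff_left:
  assumes "f \<in> L2 M" "g \<in> L2 M" "h \<in> L2 M"
  shows "L2_inner M (\<lambda>x. f x - g x) h = L2_inner M f h - L2_inner M g h"
  using L2_mult_integrable[OF assms(1) L2_cnj[OF assms(3)]] L2_mult_integrable[OF assms(2) L2_cnj[OF assms(3)]]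
  by (simp add: L2_inner_def left_diff_distrib)

lemma L2_inner_cmult_left: "L2_inner M (\<lambda>x. a * f x) h = a * L2_inner M f h"
  by (simp add: L2_inner_def mult.assoc)

lemma L2_inner_sum_left:
  assumes "\<And>k. k \<in> K \<Longrightarrow> f k \<in> L2 M" "h \<in> L2 M"
  shows "L2_inner M (\<lambda>x. \<Sum>k\<in>K. f k x) h = (\<Sum>k\<in>K. L2_inner M (f k) h)"
  unfolding L2_inner_def sum_distrib_right
  by (rule Bochner_Integration.integral_sum) (intro L2_mult_integrable assms L2_cnj)

lemma L2_inner_commute: "L2_inner M g f = cnj (L2_inner M f g)"
  unfolding L2_inner_def by (subst Bochner_Integration.integral_cnj[symmetric]) (simp add: mult.commute)

lemma L2_inner_self: "L2_inner M f f = complex_of_real ((L2_norm M f)\<^sup>2)"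
  unfolding L2_inner_def L2_norm_square integral_complex_of_real[symmetric]
  by (intro Bochner_Integration.integral_cong) (simp_all only: complex_norm_square)

text \<open>Cauchy-Schwarz makes pairing with \<open>g\<close> continuous, so norm convergence along
  finite sets becomes an unconditional sum of scalars.\<close>

lemma L2_has_sum_inner:
  assumes sum: "L2_has_sum M f s" and g: "g \<in> L2 M"
  shows "((\<lambda>k. L2_inner M (f k) g) has_sum L2_inner M s g) UNIV"
proof -
  have f: "\<And>k. f k \<in> L2 M" and s: "s \<in> L2 M"
    and lim: "((\<lambda>K. L2_norm M (\<lambda>x. (\<Sum>k\<in>K. f k x) - s x)) \<longlongrightarrow> 0) (finite_subsets_at_top UNIV)"
    using sum by (auto simp: L2_has_sum_def)
  have "((\<lambda>K. (\<Sum>k\<in>K. L2_inner M (f k) g) - L2_inner M s g) \<longlongrightarrow> 0) (finite_subsets_at_top UNIV)"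
  proof (rule Lim_null_comparison)
    show "((\<lambda>K. L2_norm M (\<lambda>x. (\<Sum>k\<in>K. f k x) - s x) * L2_norm M g) \<longlongrightarrow> 0) (finite_subsets_at_top UNIV)"
      using tendsto_mult_right[OF lim, of "L2_norm M g"] by (simp add: tendsto_mult_left_zero lim)
    have "norm ((\<Sum>k\<in>K. L2_inner M (f k) g) - L2_inner M s g)
        \<le> L2_norm M (\<lambda>x. (\<Sum>k\<in>K. f k x) - s x) * L2_norm M g" for K
    proof -
      have "(\<Sum>k\<in>K. L2_inner M (f k) g) - L2_inner M s g = L2_inner M (\<lambda>x. (\<Sum>k\<in>K. f k x) - s x) g"
        by (simp add: L2_inner_diff_left L2_inner_sum_left f s g L2_sum)
      then show ?thesis by (simp add: L2_Cauchy_Schwarz f s g L2_sum L2_diff)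
    qed
    then show "\<forall>\<^sub>F K in finite_subsets_at_top UNIV. norm ((\<Sum>k\<in>K. L2_inner M (f k) g) - L2_inner M s g)
        \<le> L2_norm M (\<lambda>x. (\<Sum>k\<in>K. f k x) - s x) * L2_norm M g" by simp
  qed
  then show ?thesis unfolding has_sum_def by (simp add: LIM_zero_iff)
qed

text \<open>A bounded operator carries convergent series to convergent series. Only the bound on the
  errors of partial sums is required, so no operator has to be defined on all of
  \<open>L2 M\<close>; this matters on the period cell, where composition with a matrix is
  controlled only for periodic functions.\<close>

lemma L2_has_sum_transfer:
  assumes sum: "L2_has_sum M f s" and f: "\<And>k. f' k \<in> L2 N" and s: "s' \<in> L2 N"
    and bd: "\<And>K. finite K \<Longrightarrow> L2_norm N (\<lambda>x. (\<Sum>k\<in>K. f' k x) - s' x) \<le> C * L2_norm M (\<lambda>x. (\<Sum>k\<in>K. f k x) - s x)"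
  shows "L2_has_sum N f' s'"
proof -
  have lim: "((\<lambda>K. L2_norm M (\<lambda>x. (\<Sum>k\<in>K. f k x) - s x)) \<longlongrightarrow> 0) (finite_subsets_at_top UNIV)"
    using sum by (auto simp: L2_has_sum_def)
  have "((\<lambda>K. L2_norm N (\<lambda>x. (\<Sum>k\<in>K. f' k x) - s' x)) \<longlongrightarrow> 0) (finite_subsets_at_top UNIV)"
  proof (rule Lim_null_comparison)
    show "((\<lambda>K. C * L2_norm M (\<lambda>x. (\<Sum>k\<in>K. f k x) - s x)) \<longlongrightarrow> 0) (finite_subsets_at_top UNIV)"
      by (rule tendsto_mult_right_zero[OF lim])
    show "\<forall>\<^sub>F K in finite_subsets_at_top UNIV. norm (L2_norm N (\<lambda>x. (\<Sum>k\<in>K. f' k x) - s' x))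
        \<le> C * L2_norm M (\<lambda>x. (\<Sum>k\<in>K. f k x) - s x)"
      using bd by (auto simp: L2_norm_nonneg eventually_finite_subsets_at_top)
  qed
  then show ?thesis using f s by (simp add: L2_has_sum_def)
qed

section \<open>Orthogonal series\<close>

lemma L2_norm_square_add_orthogonal:
  assumes u: "u \<in> L2 M" and v: "v \<in> L2 M" and o: "L2_inner M u v = 0"
  shows "(L2_norm M (\<lambda>x. u x + v x))\<^sup>2 = (L2_norm M u)\<^sup>2 + (L2_norm M v)\<^sup>2"
proof -
  have i: "integrable M (\<lambda>x. u x * cnj (v x))"
    by (intro L2_mult_integrable u L2_cnj v)
  have "(L2_norm M (\<lambda>x. u x + v x))\<^sup>2 = (LINT x|M. (cmod (u x))\<^sup>2 + (cmod (v x))\<^sup>2 + 2 * Re (u x * cnj (v x)))"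
    unfolding L2_norm_square
    by (intro Bochner_Integration.integral_cong refl)
      (simp only: cmod_power2, simp add: power2_eq_square algebra_simps)
  also have "\<dots> = (L2_norm M u)\<^sup>2 + (L2_norm M v)\<^sup>2 + 2 * Re (L2_inner M u v)"
  proof -
    have "(LINT x|M. a x + b x + 2 * Re (w x)) = (LINT x|M. a x) + (LINT x|M. b x) + 2 * Re (LINT x|M. w x)"
      if "integrable M a" "integrable M b" "integrable M w" for a b :: "'a \<Rightarrow> real" and w
      using that by simp
    from this[OF L2_square_integrable[OF u] L2_square_integrable[OF v] i] show ?thesis
      by (simp only: L2_norm_square L2_inner_def)
  qed
  finally show ?thesis using o by simp
qed

lemma L2_inner_lin_comb:
  assumes e: "\<And>k. e k \<in> L2 M"
    and orth: "\<And>k l. L2_inner M (e k) (e l) = (if k = l then of_real N else 0)"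
    and fin: "finite K"
  shows "L2_inner M (\<lambda>x. \<Sum>k\<in>K. c k * e k x) (e l) = (if l \<in> K then of_real N * c l else 0)"
proof -
  have "L2_inner M (\<lambda>x. \<Sum>k\<in>K. c k * e k x) (e l) = (\<Sum>k\<in>K. c k * L2_inner M (e k) (e l))"
    by (subst L2_inner_sum_left) (auto intro: L2_cmult e simp: L2_inner_cmult_left)
  also have "\<dots> = (\<Sum>k\<in>K. if k = l then of_real N * c k else 0)"
    by (intro sum.cong) (auto simp: orth)
  finally show ?thesis using fin by (simp add: sum.delta)
qed

lemma L2_norm_square_lin_comb:
  assumes e: "\<And>k. e k \<in> L2 M"
    and orth: "\<And>k l. L2_inner M (e k) (e l) = (if k = l then of_real N else 0)"
    and fin: "finite K"
  shows "(L2_norm M (\<lambda>x. \<Sum>k\<in>K. c k * e k x))\<^sup>2 = N * (\<Sum>k\<in>K. (cmod (c k))\<^sup>2)"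
proof -
  let ?s = "\<lambda>x. \<Sum>k\<in>K. c k * e k x"
  have s: "?s \<in> L2 M" by (intro L2_sum L2_cmult e)
  have "complex_of_real ((L2_norm M ?s)\<^sup>2) = L2_inner M ?s ?s" by (simp only: L2_inner_self)
  also have "\<dots> = (\<Sum>k\<in>K. c k * L2_inner M (e k) ?s)"
    by (subst L2_inner_sum_left) (auto intro: L2_cmult e s simp: L2_inner_cmult_left)
  also have "\<dots> = (\<Sum>k\<in>K. c k * cnj (of_real N * c k))"
    by (intro sum.cong refl, subst L2_inner_commute, subst L2_inner_lin_comb[OF e orth fin]) auto
  also have "\<dots> = (\<Sum>k\<in>K. complex_of_real (N * (cmod (c k))\<^sup>2))"
    by (intro sum.cong refl) (simp only: of_real_mult complex_norm_square, simp)
  also have "\<dots> = complex_of_real (N * (\<Sum>k\<in>K. (cmod (c k))\<^sup>2))"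
    by (simp only: sum_distrib_left of_real_sum)
  finally show ?thesis by (simp only: of_real_eq_iff)
qed

text \<open>The partial sum with the coefficients \<open>L2_inner M f (e k)\<close> is the
  orthogonal projection of \<open>f\<close> onto the span of the chosen \<open>e k\<close>, hence at
  least as close to \<open>f\<close> as any other combination of them. Density of the span then
  forces convergence, and Pythagoras bounds the sums of squares.\<close>

lemma
  assumes onb: "L2_orthonormal_basis M V e" and f: "f \<in> V"
  shows L2_orthonormal_expansion: "L2_has_sum M (\<lambda>k x. L2_inner M f (e k) * e k x) f"
    and Bessel_summable: "(\<lambda>k. (cmod (L2_inner M f (e k)))\<^sup>2) summable_on UNIV"
proof -
  have e: "\<And>k. e k \<in> L2 M"
    and orth: "\<And>k l. L2_inner M (e k) (e l) = (if k = l then of_real 1 else 0)"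
    and cl: "L2_closure M (lin_span e) = V"
    using onb by (auto simp: L2_orthonormal_basis_def)
  have fL2: "f \<in> L2 M" using f cl by (auto simp: L2_closure_def)
  define c where "c k = L2_inner M f (e k)" for k
  define S where "S K = (\<lambda>x. \<Sum>k\<in>K. c k * e k x)" for K
  have S: "S K \<in> L2 M" for K unfolding S_def by (intro L2_sum L2_cmult e)
  have res: "L2_inner M (\<lambda>x. f x - S K x) (\<lambda>x. \<Sum>k\<in>K. d k * e k x) = 0" if "finite K" for K d
  proof -
    have 1: "L2_inner M (\<lambda>x. f x - S K x) (e k) = 0" if "k \<in> K" for k
      using L2_inner_lin_comb[OF e orth \<open>finite K\<close>, of c k] that
      by (simp add: L2_inner_diff_left[OF fL2 S e]) (simp add: S_def c_def)
    have "L2_inner M (\<lambda>x. \<Sum>k\<in>K. d k * e k x) (\<lambda>x. f x - S K x)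
        = (\<Sum>k\<in>K. d k * L2_inner M (e k) (\<lambda>x. f x - S K x))"
      by (subst L2_inner_sum_left) (auto intro: L2_cmult e L2_diff fL2 S simp: L2_inner_cmult_left)
    also have "\<dots> = 0"
      by (intro sum.neutral ballI) (subst L2_inner_commute, simp add: 1)
    finally show ?thesis by (subst L2_inner_commute) simp
  qed
  have best: "L2_norm M (\<lambda>x. f x - S K x) \<le> L2_norm M (\<lambda>x. f x - (\<Sum>k\<in>K. d k * e k x))"
    if "finite K" for K d
  proof (rule power2_le_imp_le)
    have "(L2_norm M (\<lambda>x. f x - (\<Sum>k\<in>K. d k * e k x)))\<^sup>2
        = (L2_norm M (\<lambda>x. (f x - S K x) + (\<Sum>k\<in>K. (c k - d k) * e k x)))\<^sup>2"
      by (simp add: S_def left_diff_distrib sum_subtractf)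
    also have "\<dots> = (L2_norm M (\<lambda>x. f x - S K x))\<^sup>2 + (L2_norm M (\<lambda>x. \<Sum>k\<in>K. (c k - d k) * e k x))\<^sup>2"
      by (intro L2_norm_square_add_orthogonal L2_diff fL2 S L2_sum L2_cmult e res that)
    finally show "(L2_norm M (\<lambda>x. f x - S K x))\<^sup>2 \<le> (L2_norm M (\<lambda>x. f x - (\<Sum>k\<in>K. d k * e k x)))\<^sup>2"
      by simp
  qed (rule L2_norm_nonneg)
  show "(\<lambda>k. (cmod (L2_inner M f (e k)))\<^sup>2) summable_on UNIV"
  proof (rule nonneg_bounded_partial_sums_imp_summable_on)
    have "(\<Sum>k\<in>K. (cmod (L2_inner M f (e k)))\<^sup>2) \<le> (L2_norm M f)\<^sup>2" if "finite K" for K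
    proof -
      have "(L2_norm M (\<lambda>x. (f x - S K x) + (\<Sum>k\<in>K. c k * e k x)))\<^sup>2
         = (L2_norm M (\<lambda>x. f x - S K x))\<^sup>2 + (L2_norm M (\<lambda>x. \<Sum>k\<in>K. c k * e k x))\<^sup>2"
        by (intro L2_norm_square_add_orthogonal L2_diff fL2 S L2_sum L2_cmult e res that)
      then have "(L2_norm M (\<lambda>x. \<Sum>k\<in>K. c k * e k x))\<^sup>2 \<le> (L2_norm M f)\<^sup>2"
        by (simp add: S_def)
      then show ?thesis
        by (subst (asm) L2_norm_square_lin_comb[OF e orth that]) (simp add: c_def)
    qed
    then show "\<forall>\<^sub>F K in finite_subsets_at_top UNIV. (\<Sum>k\<in>K. (cmod (L2_inner M f (e k)))\<^sup>2) \<le> (L2_norm M f)\<^sup>2"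
      by (auto simp: eventually_finite_subsets_at_top)
  qed simp
  have "((\<lambda>K. L2_norm M (\<lambda>x. S K x - f x)) \<longlongrightarrow> 0) (finite_subsets_at_top UNIV)"
  proof (rule tendstoI)
    fix \<epsilon> :: real assume "\<epsilon> > 0"
    then obtain g where "g \<in> lin_span e" and g: "L2_norm M (\<lambda>x. f x - g x) < \<epsilon>"
      using f cl by (auto simp: L2_closure_def)
    then obtain K d where K: "finite K" and gd: "g = (\<lambda>x. \<Sum>k\<in>K. d k * e k x)"
      by (auto simp: lin_span_def)
    have "L2_norm M (\<lambda>x. S L x - f x) < \<epsilon>" if L: "finite L" "K \<subseteq> L" for L
    proof -
      \<comment> \<open>Padding with zero coefficients lets the same approximant compete on every
        larger index set.\<close>
      have "g = (\<lambda>x. \<Sum>k\<in>L. (if k \<in> K then d k else 0) * e k x)"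
        unfolding gd using L K by (intro ext sum.mono_neutral_cong_left) auto
      with best[OF L(1), of "\<lambda>k. if k \<in> K then d k else 0"] g
      show ?thesis by (simp add: L2_norm_minus_commute[of M f])
    qed
    with K show "\<forall>\<^sub>F K in finite_subsets_at_top UNIV. dist (L2_norm M (\<lambda>x. S K x - f x)) 0 < \<epsilon>"
      by (auto simp: eventually_finite_subsets_at_top L2_norm_nonneg intro!: exI[of _ K])
  qed
  then show "L2_has_sum M (\<lambda>k x. L2_inner M f (e k) * e k x) f"
    unfolding L2_has_sum_def S_def c_def using L2_cmult[OF e] fL2 by auto
qed

section \<open>The Riesz-Fischer theorem for orthogonal systems on a finite measure space\<close>

text \<open>The rate 1/4 is chosen for squared norms: the norms themselves then decay like (1/2)^j,
  which is summable and so yields pointwise convergence along the chosen sets.\<close>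

lemma square_summable_tails:
  fixes a :: "'k \<Rightarrow> complex"
  assumes "(\<lambda>k. (cmod (a k))\<^sup>2) summable_on UNIV"
  obtains K :: "nat \<Rightarrow> 'k set" where "incseq K" "\<And>j. finite (K j)"
    "\<And>j L. finite L \<Longrightarrow> L \<inter> K j = {} \<Longrightarrow> (\<Sum>k\<in>L. (cmod (a k))\<^sup>2) \<le> (1/4) ^ j"
proof -
  define T where "T = (\<Sum>\<^sub>\<infinity>k. (cmod (a k))\<^sup>2)"
  have lim: "((\<lambda>K. \<Sum>k\<in>K. (cmod (a k))\<^sup>2) \<longlongrightarrow> T) (finite_subsets_at_top UNIV)"
    using infsum_tendsto[OF assms] by (simp add: T_def)
  have le: "(\<Sum>k\<in>L. (cmod (a k))\<^sup>2) \<le> T" if "finite L" for L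
    unfolding T_def by (rule finite_sum_le_infsum[OF assms]) (use that in auto)
  have "\<exists>K. finite K \<and> (\<Sum>k\<in>K. (cmod (a k))\<^sup>2) > T - (1/4) ^ j" for j
  proof -
    have "\<forall>\<^sub>F K in finite_subsets_at_top UNIV. (\<Sum>k\<in>K. (cmod (a k))\<^sup>2) > T - (1/4) ^ j"
      by (rule order_tendstoD(1)[OF lim]) simp
    then show ?thesis by (auto simp: eventually_finite_subsets_at_top)
  qed
  then obtain K where K: "\<And>j. finite (K j)" "\<And>j. (\<Sum>k\<in>K j. (cmod (a k))\<^sup>2) > T - (1/4) ^ j"
    by metis
  show ?thesis
  \<comment> \<open>Unions make the sets increasing; a set disjoint from the union is disjoint from
    \<open>K j\<close>, so the tail bound survives.\<close>
  proof (rule that[of "\<lambda>j. \<Union>i\<le>j. K i"])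
    show "incseq (\<lambda>j. \<Union>i\<le>j. K i)" by (auto simp: incseq_def intro: order_trans)
    show "finite (\<Union>i\<le>j. K i)" for j using K by auto
    show "(\<Sum>k\<in>L. (cmod (a k))\<^sup>2) \<le> (1/4) ^ j" if "finite L" "L \<inter> (\<Union>i\<le>j. K i) = {}" for j L
    proof -
      have "L \<inter> K j = {}" using that(2) by auto
      then have "(\<Sum>k\<in>L \<union> K j. (cmod (a k))\<^sup>2) = (\<Sum>k\<in>L. (cmod (a k))\<^sup>2) + (\<Sum>k\<in>K j. (cmod (a k))\<^sup>2)"
        using that K by (intro sum.union_disjoint) auto
      with le[of "L \<union> K j"] that K(1) K(2)[of j] show ?thesis by simp
    qed
  qed
qed

text \<open>Cauchy-Schwarz against the constant 1, which is square integrable because the measure is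
  finite.\<close>

lemma (in finite_measure) L1_le_L2_norm:
  assumes f: "f \<in> L2 M"
  shows "(\<integral>\<^sup>+x. ennreal (cmod (f x)) \<partial>M) \<le> ennreal (L2_norm M (\<lambda>x. 1) * L2_norm M f)"
proof -
  have one: "(\<lambda>x. 1) \<in> L2 M" by (simp add: L2_def)
  have "integrable M f" using L2_mult_integrable[OF one f] by simp
  then have "(\<integral>\<^sup>+x. ennreal (cmod (f x)) \<partial>M) = ennreal (LINT x|M. cmod (f x))"
    by (intro nn_integral_eq_integral) auto
  also have "\<dots> \<le> ennreal (L2_norm M (\<lambda>x. 1) * L2_norm M f)"
    using L2_Cauchy_Schwarz_abs[OF one f] by (intro ennreal_leI) simp
  finally show ?thesis .
qed

text \<open>The absolute increments have a finite total integral, so their sum is finite almost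
  everywhere, and the telescoping series converges absolutely there.\<close>

lemma (in finite_measure) L2_fast_Cauchy_AE_convergent:
  assumes s: "\<And>j. s j \<in> L2 M"
    and fast: "\<And>j. L2_norm M (\<lambda>x. s (Suc j) x - s j x) \<le> R * (1/2) ^ j"
  shows "AE x in M. convergent (\<lambda>j. s j x)"
proof -
  let ?d = "\<lambda>j x. ennreal (cmod (s (Suc j) x - s j x))"
  define c where "c = L2_norm M (\<lambda>x. 1) * R"
  have meas: "?d j \<in> borel_measurable M" for j
    using L2_measurable[OF L2_diff[OF s s]] by measurable
  have bd: "(\<integral>\<^sup>+x. ?d j x \<partial>M) \<le> ennreal (c * (1/2) ^ j)" for j
  proof -
    have "(\<integral>\<^sup>+x. ?d j x \<partial>M) \<le> ennreal (L2_norm M (\<lambda>x. 1) * L2_norm M (\<lambda>x. s (Suc j) x - s j x))"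
      by (intro L1_le_L2_norm L2_diff s)
    also have "\<dots> \<le> ennreal (c * (1/2) ^ j)"
      unfolding c_def mult.assoc by (intro ennreal_leI mult_left_mono fast L2_norm_nonneg)
    finally show ?thesis .
  qed
  have "0 \<le> R" using fast[of 0] L2_norm_nonneg[of M "\<lambda>x. s (Suc 0) x - s 0 x"] by simp
  then have "0 \<le> c" by (simp add: c_def L2_norm_nonneg)
  have "(\<integral>\<^sup>+x. (\<Sum>j. ?d j x) \<partial>M) = (\<Sum>j. \<integral>\<^sup>+x. ?d j x \<partial>M)"
    by (rule nn_integral_suminf) (rule meas)
  also have "\<dots> \<le> (\<Sum>j. ennreal (c * (1/2) ^ j))"
    by (intro suminf_le bd summableI)
  also have "\<dots> < \<infinity>"
  proof -
    have "(\<Sum>j. ennreal (c * (1/2) ^ j)) \<noteq> \<infinity>"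
      unfolding infinity_ennreal_def using \<open>0 \<le> c\<close>
      by (intro ennreal_suminf_neq_top summable_mult summable_geometric) auto
    then show ?thesis by (simp add: less_top)
  qed
  finally have "(\<integral>\<^sup>+x. (\<Sum>j. ?d j x) \<partial>M) \<noteq> \<infinity>" by simp
  then have "AE x in M. (\<Sum>j. ?d j x) \<noteq> \<infinity>"
    by (intro nn_integral_PInf_AE) (use meas in measurable)
  then show ?thesis
  proof eventually_elim
    case (elim x)
    then have "summable (\<lambda>j. cmod (s (Suc j) x - s j x))"
      by (intro summable_suminf_not_top) auto
    then have "summable (\<lambda>j. s (Suc j) x - s j x)" by (rule summable_norm_cancel)
    then have "convergent (\<lambda>n. \<Sum>j<n. s (Suc j) x - s j x)" by (simp add: summable_iff_convergent)
    then have "convergent (\<lambda>n. s n x - s 0 x)"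
      by (simp only: sum_lessThan_telescope[of "\<lambda>j. s j x"])
    from convergent_add[OF this convergent_const[of "s 0 x"]] show ?case by simp
  qed
qed

text \<open>Fatou's lemma for the squared moduli, applied to the sequence shifted by
  \<open>i\<close> so that the bound holds for every term.\<close>

lemma L2_norm_AE_limit_le:
  assumes u: "\<And>j. u j \<in> L2 M" and v: "v \<in> borel_measurable M"
    and lim: "AE x in M. (\<lambda>j. u j x) \<longlonglongrightarrow> v x"
    and bd: "\<And>j. j \<ge> i \<Longrightarrow> L2_norm M (u j) \<le> r"
  shows "v \<in> L2 M" "L2_norm M v \<le> r"
proof -
  have r0: "0 \<le> r" using bd[of i] L2_norm_nonneg[of M "u i"] by simp
  have [measurable]: "u j \<in> borel_measurable M" for j by (rule L2_measurable[OF u])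
  have "(\<integral>\<^sup>+x. ennreal ((cmod (v x))\<^sup>2) \<partial>M) = (\<integral>\<^sup>+x. liminf (\<lambda>j. ennreal ((cmod (u (j + i) x))\<^sup>2)) \<partial>M)"
  proof (rule nn_integral_cong_AE, use lim in eventually_elim)
    case (elim x)
    then have "(\<lambda>j. ennreal ((cmod (u (j + i) x))\<^sup>2)) \<longlonglongrightarrow> ennreal ((cmod (v x))\<^sup>2)"
      by (intro tendsto_ennrealI tendsto_intros LIMSEQ_ignore_initial_segment)
    from lim_imp_Liminf[OF _ this] show ?case by simp
  qed
  also have "\<dots> \<le> liminf (\<lambda>j. \<integral>\<^sup>+x. ennreal ((cmod (u (j + i) x))\<^sup>2) \<partial>M)"
    by (rule nn_integral_liminf) measurable
  also have "\<dots> \<le> limsup (\<lambda>j. \<integral>\<^sup>+x. ennreal ((cmod (u (j + i) x))\<^sup>2) \<partial>M)"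
    by (rule Liminf_le_Limsup) simp
  also have "\<dots> \<le> ennreal (r\<^sup>2)"
  proof (rule Limsup_bounded, rule always_eventually, rule allI)
    fix j
    have "(\<integral>\<^sup>+x. ennreal ((cmod (u (j + i) x))\<^sup>2) \<partial>M) = ennreal ((L2_norm M (u (j + i)))\<^sup>2)"
      unfolding L2_norm_square using L2_square_integrable[OF u] by (intro nn_integral_eq_integral) auto
    also have "\<dots> \<le> ennreal (r\<^sup>2)"
      by (intro ennreal_leI power_mono bd L2_norm_nonneg) simp
    finally show "(\<integral>\<^sup>+x. ennreal ((cmod (u (j + i) x))\<^sup>2) \<partial>M) \<le> ennreal (r\<^sup>2)" .
  qed
  finally have le: "(\<integral>\<^sup>+x. ennreal ((cmod (v x))\<^sup>2) \<partial>M) \<le> ennreal (r\<^sup>2)" .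
  then show vL2: "v \<in> L2 M"
    using v unfolding L2_iff_nn_integral by (auto intro: le_less_trans)
  have "(\<integral>\<^sup>+x. ennreal ((cmod (v x))\<^sup>2) \<partial>M) = ennreal ((L2_norm M v)\<^sup>2)"
    unfolding L2_norm_square using L2_square_integrable[OF vL2] by (intro nn_integral_eq_integral) auto
  with le have "(L2_norm M v)\<^sup>2 \<le> r\<^sup>2" by simp
  with r0 show "L2_norm M v \<le> r" by (rule power2_le_imp_le[rotated])
qed

text \<open>Partial sums over the sets \<open>K j\<close> converge almost everywhere because their
  increments decay geometrically in norm. The sum is exhibited as a pointwise \<open>lim\<close> so
  that properties shared by all \<open>e k\<close>, such as exact periodicity, pass to it at every
  point. The constant \<open>N\<close> allows the characters to be used without
  normalization.\<close>

lemma (in finite_measure) Riesz_Fischer: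
  fixes e :: "'k \<Rightarrow> 'a \<Rightarrow> complex"
  assumes e: "\<And>k. e k \<in> L2 M"
    and orth: "\<And>k l. L2_inner M (e k) (e l) = (if k = l then of_real N else 0)"
    and summ: "(\<lambda>k. (cmod (a k))\<^sup>2) summable_on UNIV"
  obtains K :: "nat \<Rightarrow> 'k set" where "\<And>j. finite (K j)"
    "L2_has_sum M (\<lambda>k x. a k * e k x) (\<lambda>x. lim (\<lambda>j. \<Sum>k\<in>K j. a k * e k x))"
proof -
  obtain K where K: "incseq K" "\<And>j. finite (K j)"
    and tail: "\<And>j L. finite L \<Longrightarrow> L \<inter> K j = {} \<Longrightarrow> (\<Sum>k\<in>L. (cmod (a k))\<^sup>2) \<le> (1/4) ^ j"
    using square_summable_tails[OF summ] by blast
  define S where "S L = (\<lambda>x. \<Sum>k\<in>L. a k * e k x)" for L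
  define m where "m = (\<lambda>x. lim (\<lambda>j. S (K j) x))"
  define R where "R = sqrt N"
  have S: "S L \<in> L2 M" for L unfolding S_def by (intro L2_sum L2_cmult e)
  \<comment> \<open>\<open>N\<close> is the squared norm of any \<open>e k\<close>; the index type
    is inhabited.\<close>
  have "0 \<le> N"
  proof -
    have "complex_of_real N = complex_of_real ((L2_norm M (e k))\<^sup>2)" for k
      using orth[of k k] by (simp add: L2_inner_self)
    then have "N = (L2_norm M (e k))\<^sup>2" for k by (simp only: of_real_eq_iff)
    then show ?thesis by (metis zero_le_power2)
  qed
  then have R: "0 \<le> R" "R\<^sup>2 = N" by (simp_all add: R_def)
  have diff: "L2_norm M (\<lambda>x. S L x - S (K j) x) \<le> R * (1/2) ^ j" if "finite L" "K j \<subseteq> L" for L j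
  proof (rule power2_le_imp_le)
    have "(\<lambda>x. S L x - S (K j) x) = S (L - K j)"
      using that by (auto simp: S_def sum_diff)
    then have "(L2_norm M (\<lambda>x. S L x - S (K j) x))\<^sup>2 = N * (\<Sum>k\<in>L - K j. (cmod (a k))\<^sup>2)"
      using L2_norm_square_lin_comb[OF e orth, of "L - K j" a] that by (simp add: S_def)
    also have "\<dots> \<le> N * (1/4) ^ j"
      using that \<open>0 \<le> N\<close> by (intro mult_left_mono tail) auto
    also have "\<dots> = (R * (1/2) ^ j)\<^sup>2"
      by (simp add: R power_mult_distrib power_mult[symmetric] mult.commute[of _ 2])
        (simp add: power_mult power2_eq_square)
    finally show "(L2_norm M (\<lambda>x. S L x - S (K j) x))\<^sup>2 \<le> (R * (1/2) ^ j)\<^sup>2" .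
  qed (use R in simp)
  have "L2_norm M (\<lambda>x. S (K (Suc j)) x - S (K j) x) \<le> R * (1/2) ^ j" for j
    by (rule diff[OF K(2) incseq_SucD[OF K(1)]])
  then have "AE x in M. convergent (\<lambda>j. S (K j) x)"
    by (rule L2_fast_Cauchy_AE_convergent[OF S])
  then have conv: "AE x in M. (\<lambda>j. S (K j) x) \<longlonglongrightarrow> m x"
    by (simp add: m_def convergent_LIMSEQ_iff)
  have m_meas: "m \<in> borel_measurable M"
    unfolding m_def by (intro borel_measurable_lim_metric L2_measurable S)
  have est: "(\<lambda>x. S L x - m x) \<in> L2 M \<and> L2_norm M (\<lambda>x. S L x - m x) \<le> 2 * R * (1/2) ^ i"
    if L: "finite L" "K i \<subseteq> L" for L i
  proof -
    \<comment> \<open>Each of the two legs, from \<open>S L\<close> to \<open>S (K i)\<close> and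
      from there to \<open>S (K j)\<close>, costs at most \<open>R * (1/2) ^ i\<close>, which
      explains the factor 2. The bound is uniform in j and therefore passes to the limit
      \<open>m\<close>.\<close>
    have bd: "L2_norm M (\<lambda>x. S L x - S (K j) x) \<le> 2 * R * (1/2) ^ i" if "j \<ge> i" for j
    proof -
      have "K i \<subseteq> K j" using K(1) that by (auto simp: incseq_def)
      then have "L2_norm M (\<lambda>x. S (K j) x - S (K i) x) \<le> R * (1/2) ^ i" by (intro diff K)
      then have "L2_norm M (\<lambda>x. S (K i) x - S (K j) x) \<le> R * (1/2) ^ i"
        by (subst L2_norm_minus_commute)
      with diff[OF L] L2_norm_triangle_diff[OF S[of L] S[of "K i"] S[of "K j"]] show ?thesis by simp
    qed
    have lim: "AE x in M. (\<lambda>j. S L x - S (K j) x) \<longlonglongrightarrow> S L x - m x"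
      using conv by eventually_elim (intro tendsto_intros)
    have "(\<lambda>x. S L x - m x) \<in> borel_measurable M"
      by (intro borel_measurable_diff m_meas L2_measurable S)
    from L2_norm_AE_limit_le[OF L2_diff[OF S S] this lim bd] show ?thesis by blast
  qed
  \<comment> \<open>Written as \<open>S (K 0)\<close> minus the difference
    \<open>S (K 0) - m\<close>, both square integrable.\<close>
  have mL2: "m \<in> L2 M"
    using L2_diff[OF S[of "K 0"] conjunct1[OF est[of "K 0" 0]]] K(2) by simp
  have "((\<lambda>L. L2_norm M (\<lambda>x. S L x - m x)) \<longlongrightarrow> 0) (finite_subsets_at_top UNIV)"
  proof (rule tendstoI)
    fix \<epsilon> :: real assume "\<epsilon> > 0"
    have "(\<lambda>i. 2 * R * (1/2) ^ i) \<longlonglongrightarrow> 0"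
      by (intro tendsto_mult_right_zero LIMSEQ_realpow_zero) auto
    from order_tendstoD(2)[OF this \<open>\<epsilon> > 0\<close>] obtain i where "2 * R * (1/2) ^ i < \<epsilon>"
      by (auto simp: eventually_sequentially)
    then have "L2_norm M (\<lambda>x. S L x - m x) < \<epsilon>" if "finite L" "K i \<subseteq> L" for L
      using est[OF that] by linarith
    with K(2)[of i] show "\<forall>\<^sub>F L in finite_subsets_at_top UNIV. dist (L2_norm M (\<lambda>x. S L x - m x)) 0 < \<epsilon>"
      by (auto simp: eventually_finite_subsets_at_top L2_norm_nonneg intro!: exI[of _ "K i"])
  qed
  then have "L2_has_sum M (\<lambda>k x. a k * e k x) m"
    unfolding L2_has_sum_def S_def using L2_cmult[OF e] mL2 by auto
  with K(2) show ?thesis unfolding m_def S_def by (rule that)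
qed

section \<open>Linear changes of variables\<close>

lemma nn_integral_lborel_translation:
  fixes f :: "'a::euclidean_space \<Rightarrow> ennreal"
  assumes [measurable]: "f \<in> borel_measurable borel"
  shows "(\<integral>\<^sup>+x. f (c + x) \<partial>lborel) = (\<integral>\<^sup>+x. f x \<partial>lborel)"
  using nn_integral_distr[of "(+) c" lborel borel f] by (simp add: lborel_distr_plus)

lemma integral_lborel_translation:
  fixes f :: "'a::euclidean_space \<Rightarrow> complex"
  assumes [measurable]: "f \<in> borel_measurable borel"
  shows "(LINT x|lborel. f (c + x)) = (LINT x|lborel. f x)"
  using integral_distr[of "(+) c" lborel borel f] by (simp add: lborel_distr_plus)

lemma matrix_vector_mult_measurable [measurable]:
  "(\<lambda>x. M *v x) \<in> borel_measurable (borel :: (real^'n) measure)" for M :: "real^'n^'m"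
  by (intro borel_measurable_continuous_onI continuous_intros)

text \<open>Uniqueness of Haar measure up to a factor, by exchanging the order of integration in
  \<open>\<integral>\<integral> g x * f (x + M y)\<close>; the exact factor \<open>1 / \<bar>det M\<bar>\<close> plays no role.\<close>

lemma nn_integral_lborel_linear:
  fixes M :: "real^'n^'n"
  assumes inv: "invertible M"
  obtains C :: real where "C \<ge> 0"
    "\<And>f :: real^'n \<Rightarrow> ennreal. f \<in> borel_measurable borel \<Longrightarrow>
       (\<integral>\<^sup>+x. f (M *v x) \<partial>lborel) = ennreal C * (\<integral>\<^sup>+x. f x \<partial>lborel)"
proof -
  obtain M' where M': "M ** M' = Finite_Cartesian_Product.mat 1" "M' ** M = Finite_Cartesian_Product.mat 1"
    using inv by (auto simp: invertible_def)
  have MM': "M *v (M' *v x) = x" "M' *v (M *v x) = x" for x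
    by (simp_all add: matrix_vector_mul_assoc M')
  define J where "J f = (\<integral>\<^sup>+x. f (M *v x) \<partial>lborel)" for f :: "real^'n \<Rightarrow> ennreal"
  \<comment> \<open>The unit ball serves as reference set: its measure is positive and finite, and
    its symmetry about 0 lets g (x - z) be replaced by g (z - x) below.\<close>
  define g :: "real^'n \<Rightarrow> ennreal" where "g = indicator (ball 0 1)"
  define c where "c = emeasure lborel (ball (0::real^'n) 1)"
  define d where "d = J g"
  have [measurable]: "g \<in> borel_measurable borel" unfolding g_def by (intro borel_measurable_indicator) simp
  \<comment> \<open>As \<open>M\<close> is onto, a translation by x after \<open>M\<close> is a
    translation by \<open>M' *v x\<close> before it, so \<open>J\<close> inherits translation
    invariance.\<close>
  have J_trans: "J (\<lambda>y. f (x + y)) = J f" if [measurable]: "f \<in> borel_measurable borel" for f x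
  proof -
    have "J (\<lambda>y. f (x + y)) = (\<integral>\<^sup>+y. f (M *v (M' *v x + y)) \<partial>lborel)"
      by (simp add: J_def matrix_vector_right_distrib MM')
    also have "\<dots> = J f" unfolding J_def by (intro nn_integral_lborel_translation) simp
    finally show ?thesis .
  qed
  have cpos: "c > 0" and cfin: "c < \<infinity>"
    by (simp_all add: c_def emeasure_ball unit_ball_vol_pos)
  have d_eq: "d = emeasure lborel ((\<lambda>x. M *v x) -` ball 0 1)"
  proof -
    have "(\<lambda>x. g (M *v x)) = indicator ((\<lambda>x. M *v x) -` ball 0 1)"
      by (auto simp: g_def indicator_def fun_eq_iff)
    moreover have "(\<lambda>x. M *v x) -` ball 0 1 \<in> sets borel"
      using measurable_sets[OF matrix_vector_mult_measurable, of "ball 0 1" M] by simp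
    ultimately show ?thesis by (simp add: d_def J_def)
  qed
  \<comment> \<open>The preimage of the ball under \<open>M\<close> lies in its image under the
    inverse, so it is bounded and has finite measure.\<close>
  have "bounded ((\<lambda>x. M' *v x) ` ball 0 1)"
    by (intro bounded_linear_image bounded_ball matrix_vector_mul_bounded_linear)
  moreover have "(\<lambda>x. M *v x) -` ball 0 1 \<subseteq> (\<lambda>x. M' *v x) ` ball 0 1"
    by (metis MM'(2) imageI subsetI vimageE)
  ultimately have "bounded ((\<lambda>x. M *v x) -` ball 0 1)" by (rule bounded_subset)
  then have dfin: "d < \<infinity>" unfolding d_eq by (rule emeasure_bounded_finite)
  have key: "J f * c = d * (\<integral>\<^sup>+x. f x \<partial>lborel)" if [measurable]: "f \<in> borel_measurable borel" for f
  proof -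
    have "c = (\<integral>\<^sup>+x. g x \<partial>lborel)"
      by (simp add: g_def c_def)
    then have "J f * c = (\<integral>\<^sup>+x. g x \<partial>lborel) * J f"
      by (simp only: mult.commute)
    also have "\<dots> = (\<integral>\<^sup>+x. g x * J f \<partial>lborel)"
      by (rule nn_integral_multc[symmetric]) measurable
    also have "\<dots> = (\<integral>\<^sup>+x. (\<integral>\<^sup>+y. g x * f (x + M *v y) \<partial>lborel) \<partial>lborel)"
    proof (rule nn_integral_cong)
      fix x
      have "g x * J f = g x * J (\<lambda>y. f (x + y))" by (simp only: J_trans[OF that])
      also have "\<dots> = (\<integral>\<^sup>+y. g x * f (x + M *v y) \<partial>lborel)"
        unfolding J_def by (rule nn_integral_cmult[symmetric]) measurable
      finally show "g x * J f = (\<integral>\<^sup>+y. g x * f (x + M *v y) \<partial>lborel)" .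
    qed
    also have "\<dots> = (\<integral>\<^sup>+y. (\<integral>\<^sup>+x. g x * f (x + M *v y) \<partial>lborel) \<partial>lborel)"
      by (rule lborel_pair.Fubini') measurable
    \<comment> \<open>Translating x by \<open>M *v y\<close> moves the matrix from \<open>f\<close>
      to \<open>g\<close>; after exchanging the integrals again, the inner one is the constant
      \<open>d\<close>.\<close>
    also have "\<dots> = (\<integral>\<^sup>+y. (\<integral>\<^sup>+x. g (x - M *v y) * f x \<partial>lborel) \<partial>lborel)"
    proof (rule nn_integral_cong)
      fix y
      have "(\<integral>\<^sup>+x. g (x - M *v y) * f x \<partial>lborel) = (\<integral>\<^sup>+x. g ((M *v y + x) - M *v y) * f (M *v y + x) \<partial>lborel)"
        by (rule nn_integral_lborel_translation[symmetric]) measurable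
      then show "(\<integral>\<^sup>+x. g x * f (x + M *v y) \<partial>lborel) = (\<integral>\<^sup>+x. g (x - M *v y) * f x \<partial>lborel)"
        by (simp add: add.commute)
    qed
    also have "\<dots> = (\<integral>\<^sup>+x. (\<integral>\<^sup>+y. g (x - M *v y) * f x \<partial>lborel) \<partial>lborel)"
      by (rule lborel_pair.Fubini') measurable
    also have "\<dots> = (\<integral>\<^sup>+x. J (\<lambda>y. g (- x + y)) * f x \<partial>lborel)"
    proof (rule nn_integral_cong)
      fix x
      have "g (x - z) = g (- x + z)" for z
        by (auto simp: g_def indicator_def norm_minus_commute)
      then have "(\<integral>\<^sup>+y. g (x - M *v y) * f x \<partial>lborel) = (\<integral>\<^sup>+y. g (- x + M *v y) * f x \<partial>lborel)"
        by simp
      also have "\<dots> = J (\<lambda>y. g (- x + y)) * f x"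
        unfolding J_def by (rule nn_integral_multc) measurable
      finally show "(\<integral>\<^sup>+y. g (x - M *v y) * f x \<partial>lborel) = J (\<lambda>y. g (- x + y)) * f x" .
    qed
    also have "\<dots> = d * (\<integral>\<^sup>+x. f x \<partial>lborel)"
      unfolding d_def by (subst J_trans) (auto simp: nn_integral_cmult)
    finally show ?thesis .
  qed
  obtain c' where c': "c = ennreal c'" "c' > 0" using cpos cfin by (cases c) auto
  obtain d' where d': "d = ennreal d'" "d' \<ge> 0" using dfin by (cases d) auto
  have "(\<integral>\<^sup>+x. f (M *v x) \<partial>lborel) = ennreal (d' / c') * (\<integral>\<^sup>+x. f x \<partial>lborel)"
    if "f \<in> borel_measurable borel" for f
  proof -
    have "J f = J f * c * ennreal (1 / c')"
    proof -
      have "ennreal c' * ennreal (1 / c') = 1"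
        using c'(2) by (subst ennreal_mult[symmetric]) auto
      then show ?thesis by (simp add: c'(1) mult.assoc)
    qed
    also have "\<dots> = ennreal (1 / c') * ennreal d' * (\<integral>\<^sup>+x. f x \<partial>lborel)"
      unfolding key[OF that] d' by (simp add: ac_simps)
    also have "ennreal (1 / c') * ennreal d' = ennreal (d' / c')"
      using c'(2) d'(2) by (subst ennreal_mult[symmetric]) auto
    finally show ?thesis by (simp add: J_def)
  qed
  with c' d' show ?thesis by (intro that[of "d' / c'"]) auto
qed

lemma L2_norm_le_of_nn_integral:
  assumes f: "f \<in> L2 M" and g: "g \<in> borel_measurable N" and C: "C \<ge> 0"
    and le: "(\<integral>\<^sup>+x. ennreal ((cmod (g x))\<^sup>2) \<partial>N) \<le> ennreal C * (\<integral>\<^sup>+x. ennreal ((cmod (f x))\<^sup>2) \<partial>M)"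
  shows "g \<in> L2 N" "L2_norm N g \<le> sqrt C * L2_norm M f"
proof -
  have "(\<integral>\<^sup>+x. ennreal ((cmod (f x))\<^sup>2) \<partial>M) = ennreal (LINT x|M. (cmod (f x))\<^sup>2)"
    using f by (intro nn_integral_eq_integral) (auto simp: L2_def)
  with le C have le': "(\<integral>\<^sup>+x. ennreal ((cmod (g x))\<^sup>2) \<partial>N) \<le> ennreal (C * (LINT x|M. (cmod (f x))\<^sup>2))"
    by (simp add: ennreal_mult)
  then show gL2: "g \<in> L2 N"
    using g unfolding L2_iff_nn_integral by (auto simp: top_unique less_top[symmetric] intro: le_less_trans)
  have "(\<integral>\<^sup>+x. ennreal ((cmod (g x))\<^sup>2) \<partial>N) = ennreal (LINT x|N. (cmod (g x))\<^sup>2)"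
    using gL2 by (intro nn_integral_eq_integral) (auto simp: L2_def)
  with le' have "(LINT x|N. (cmod (g x))\<^sup>2) \<le> C * (LINT x|M. (cmod (f x))\<^sup>2)"
    using C by (simp add: ennreal_le_iff)
  then have "sqrt (LINT x|N. (cmod (g x))\<^sup>2) \<le> sqrt (C * (LINT x|M. (cmod (f x))\<^sup>2))"
    by (rule real_sqrt_le_mono)
  then show "L2_norm N g \<le> sqrt C * L2_norm M f"
    by (simp add: L2_norm_def real_sqrt_mult)
qed

lemma L2_norm_linear:
  fixes M :: "real^'n^'n"
  assumes "invertible M"
  obtains C where "\<And>f. f \<in> L2 lborel \<Longrightarrow> (\<lambda>x. f (M *v x)) \<in> L2 lborel"
    "\<And>f. f \<in> L2 lborel \<Longrightarrow> L2_norm lborel (\<lambda>x. f (M *v x)) \<le> C * L2_norm lborel f"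
proof -
  obtain C where C: "C \<ge> 0" "\<And>f :: real^'n \<Rightarrow> ennreal. f \<in> borel_measurable borel \<Longrightarrow>
       (\<integral>\<^sup>+x. f (M *v x) \<partial>lborel) = ennreal C * (\<integral>\<^sup>+x. f x \<partial>lborel)"
    by (rule nn_integral_lborel_linear[OF assms]) blast
  have "(\<lambda>x. f (M *v x)) \<in> borel_measurable lborel"
    "(\<integral>\<^sup>+x. ennreal ((cmod (f (M *v x)))\<^sup>2) \<partial>lborel) \<le> ennreal C * (\<integral>\<^sup>+x. ennreal ((cmod (f x))\<^sup>2) \<partial>lborel)"
    if "f \<in> L2 lborel" for f
  proof -
    have [measurable]: "f \<in> borel_measurable borel" using L2_measurable[OF that] by simp
    show "(\<lambda>x. f (M *v x)) \<in> borel_measurable lborel" by measurable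
    show "(\<integral>\<^sup>+x. ennreal ((cmod (f (M *v x)))\<^sup>2) \<partial>lborel) \<le> ennreal C * (\<integral>\<^sup>+x. ennreal ((cmod (f x))\<^sup>2) \<partial>lborel)"
      by (subst C(2)[of "\<lambda>x. ennreal ((cmod (f x))\<^sup>2)"]) auto
  qed
  note * = this
  show ?thesis
    by (rule that; rule L2_norm_le_of_nn_integral) (use * C(1) in auto)
qed

section \<open>Commuting dilation pairs\<close>

text \<open>Together with injectivity, surjectivity and the image of the identity, this makes
  \<open>reindexed_mat\<close> an isomorphism between the two types of matrices, so that block
  computations can be carried back to \<open>real^'n^'n\<close>.\<close>

lemma reindexed_mat_mult:
  assumes s: "bij_betw \<sigma> {..<CARD('n)} (UNIV :: 'n::finite set)"
  shows "reindexed_mat \<sigma> (M ** N) = reindexed_mat \<sigma> M * reindexed_mat \<sigma> (N :: real^'n^'n)"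
proof (rule eq_matI)
  fix i j assume "i < dim_row (reindexed_mat \<sigma> M * reindexed_mat \<sigma> N)"
    "j < dim_col (reindexed_mat \<sigma> M * reindexed_mat \<sigma> N)"
  then have ij: "i < CARD('n)" "j < CARD('n)" by (auto simp: reindexed_mat_def)
  have "(\<Sum>k\<in>UNIV. M $ \<sigma> i $ k * N $ k $ \<sigma> j) = (\<Sum>k<CARD('n). M $ \<sigma> i $ \<sigma> k * N $ \<sigma> k $ \<sigma> j)"
    by (rule sum.reindex_bij_betw[OF s, symmetric])
  then show "reindexed_mat \<sigma> (M ** N) $$ (i, j) = (reindexed_mat \<sigma> M * reindexed_mat \<sigma> N) $$ (i, j)"
    using ij by (simp add: reindexed_mat_def matrix_matrix_mult_def Matrix.scalar_prod_def lessThan_atLeast0)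
qed (auto simp: reindexed_mat_def)

text \<open>The positions r and t are found before M is chosen, so one pair of indices serves
  several matrices at once.\<close>

lemma reindexed_mat_entry:
  assumes s: "bij_betw \<sigma> {..<CARD('n)} (UNIV :: 'n::finite set)"
  obtains r t where "r < CARD('n)" "t < CARD('n)" "\<And>M :: real^'n^'n. M $ i $ j = reindexed_mat \<sigma> M $$ (r, t)"
proof -
  have "i \<in> \<sigma> ` {..<CARD('n)}" "j \<in> \<sigma> ` {..<CARD('n)}"
    using s by (auto simp: bij_betw_def)
  then obtain r t where "r < CARD('n)" "t < CARD('n)" "\<sigma> r = i" "\<sigma> t = j" by blast
  with that[of r t] show ?thesis by (simp add: reindexed_mat_def)
qed

lemma reindexed_mat_inject:
  assumes s: "bij_betw \<sigma> {..<CARD('n)} (UNIV :: 'n::finite set)"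
    and eq: "reindexed_mat \<sigma> M = reindexed_mat \<sigma> (N :: real^'n^'n)"
  shows "M = N"
proof -
  have "M $ i $ j = N $ i $ j" for i j
    by (rule reindexed_mat_entry[OF s, of i j]) (simp add: eq)
  then show ?thesis by (simp add: vec_eq_iff)
qed

lemma reindexed_mat_one:
  assumes s: "bij_betw \<sigma> {..<CARD('n)} (UNIV :: 'n::finite set)"
  shows "reindexed_mat \<sigma> (Finite_Cartesian_Product.mat 1 :: real^'n^'n) = 1\<^sub>m CARD('n)"
  using s by (intro eq_matI) (auto simp: reindexed_mat_def Finite_Cartesian_Product.mat_def bij_betw_def inj_on_def)

lemma reindexed_mat_surj:
  assumes s: "bij_betw \<sigma> {..<CARD('n)} (UNIV :: 'n::finite set)"
    and N: "N \<in> carrier_mat CARD('n) CARD('n)"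
  obtains M :: "real^'n^'n" where "reindexed_mat \<sigma> M = N"
proof -
  define t where "t = inv_into {..<CARD('n)} \<sigma>"
  have t: "t (\<sigma> i) = i" if "i < CARD('n)" for i
    using that s by (simp add: t_def bij_betw_def inv_into_f_f)
  have "reindexed_mat \<sigma> (\<chi> i j. N $$ (t i, t j)) = N"
    using N by (intro eq_matI) (auto simp: reindexed_mat_def t)
  then show ?thesis by (rule that)
qed

lemma invertible_reindexed_mat:
  assumes s: "bij_betw \<sigma> {..<CARD('n)} (UNIV :: 'n::finite set)"
    and N: "N \<in> carrier_mat CARD('n) CARD('n)" and inv: "reindexed_mat \<sigma> M * N = 1\<^sub>m CARD('n)"
  shows "invertible (M :: real^'n^'n)"
proof -
  obtain M' :: "real^'n^'n" where "reindexed_mat \<sigma> M' = N" by (rule reindexed_mat_surj[OF s N])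
  with inv have "reindexed_mat \<sigma> (M ** M') = reindexed_mat \<sigma> (Finite_Cartesian_Product.mat 1)"
    by (simp add: reindexed_mat_mult[OF s] reindexed_mat_one[OF s])
  then show ?thesis using reindexed_mat_inject[OF s] invertible_right_inverse by blast
qed

lemma dilation_matrix_entry:
  assumes "dilation_matrix M" "M \<in> carrier_mat p q" "i < p" "j < q"
  shows "M $$ (i, j) \<in> \<int>"
proof -
  have "M $$ (i, j) \<in> elements_mat M"
    using assms(2-4) by (auto intro!: elements_matI)
  then show ?thesis using assms(1) by (auto simp: dilation_matrix_def)
qed

lemma invertible_mat_inverse:
  assumes "invertible_mat (M :: real Matrix.mat)" "M \<in> carrier_mat p p"
  obtains N where "N \<in> carrier_mat p p" "M * N = 1\<^sub>m p"
proof -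
  obtain N where N: "M * N = 1\<^sub>m (dim_row M)" "N * M = 1\<^sub>m (dim_row N)"
    using assms(1) unfolding invertible_mat_def inverts_mat_def by auto
  have "dim_row N = p" using arg_cong[OF N(2), of dim_col] assms(2) by simp
  moreover have "dim_col N = p" using arg_cong[OF N(1), of dim_col] assms(2) by simp
  ultimately show ?thesis using that[of N] N(1) assms(2) by auto
qed

text \<open>The nontrivial blocks of A and B act on complementary coordinates, so both products are
  the block matrix with diagonal blocks \<open>A'\<close> and \<open>B'\<close>. Integer entries
  will make A and B act on the lattice, invertibility gives bounded changes of variables, and
  commutation identifies the two expansions.\<close>

lemma commuting_dilation_pair_properties:
  fixes A B :: "real^'n^'n"
  assumes "commuting_dilation_pair A B"
  shows "invertible A" "invertible B" "A ** B = B ** A" "A $ i $ j \<in> \<int>" "B $ i $ j \<in> \<int>"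
proof -
  obtain \<sigma> p q A' B' where s: "bij_betw \<sigma> {..<CARD('n)} (UNIV :: 'n set)" and pq: "p + q = CARD('n)"
    and A': "A' \<in> carrier_mat p p" "invertible_mat A'" "dilation_matrix A'"
    and B': "B' \<in> carrier_mat q q" "invertible_mat B'" "dilation_matrix B'"
    and A: "reindexed_mat \<sigma> A = four_block_mat A' (0\<^sub>m p q) (0\<^sub>m q p) (1\<^sub>m q)"
    and B: "reindexed_mat \<sigma> B = four_block_mat (1\<^sub>m p) (0\<^sub>m p q) (0\<^sub>m q p) B'"
    using assms unfolding commuting_dilation_pair_def by blast
  obtain A'' where A'': "A'' \<in> carrier_mat p p" "A' * A'' = 1\<^sub>m p"
    by (rule invertible_mat_inverse[OF A'(2,1)])
  obtain B'' where B'': "B'' \<in> carrier_mat q q" "B' * B'' = 1\<^sub>m q"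
    by (rule invertible_mat_inverse[OF B'(2,1)])
  have mult: "four_block_mat X (0\<^sub>m p q) (0\<^sub>m q p) Y * four_block_mat X' (0\<^sub>m p q) (0\<^sub>m q p) Y'
      = four_block_mat (X * X') (0\<^sub>m p q) (0\<^sub>m q p) (Y * Y')"
    if "X \<in> carrier_mat p p" "X' \<in> carrier_mat p p" "Y \<in> carrier_mat q q" "Y' \<in> carrier_mat q q"
    for X X' Y Y' :: "real Matrix.mat"
    using that by (subst mult_four_block_mat[OF that(1) _ _ that(3) that(2) _ _ that(4)]) auto
  have one: "four_block_mat (1\<^sub>m p) (0\<^sub>m p q) (0\<^sub>m q p) (1\<^sub>m q) = (1\<^sub>m CARD('n) :: real Matrix.mat)"
    using pq by simp
  show "invertible A"
    by (rule invertible_reindexed_mat[OF s, of "four_block_mat A'' (0\<^sub>m p q) (0\<^sub>m q p) (1\<^sub>m q)"])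
      (use A'' A' pq in \<open>auto simp: A mult one\<close>)
  show "invertible B"
    by (rule invertible_reindexed_mat[OF s, of "four_block_mat (1\<^sub>m p) (0\<^sub>m p q) (0\<^sub>m q p) B''"])
      (use B'' B' pq in \<open>auto simp: B mult one\<close>)
  have "reindexed_mat \<sigma> (A ** B) = reindexed_mat \<sigma> (B ** A)"
    using A' B' by (simp add: reindexed_mat_mult[OF s] A B mult)
  then show "A ** B = B ** A" by (rule reindexed_mat_inject[OF s])
  obtain r t where rt: "r < CARD('n)" "t < CARD('n)" "\<And>M :: real^'n^'n. M $ i $ j = reindexed_mat \<sigma> M $$ (r, t)"
    by (rule reindexed_mat_entry[OF s, where i = i and j = j]) blast
  show "A $ i $ j \<in> \<int>"
    unfolding rt(3) A using rt(1,2) pq A'(1) by (auto simp: dilation_matrix_entry[OF A'(3,1)])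
  show "B $ i $ j \<in> \<int>"
    unfolding rt(3) B using rt(1,2) pq B'(1) by (auto simp: dilation_matrix_entry[OF B'(3,1)])
qed

section \<open>Characters of the torus\<close>

text \<open>The sign in the exponent is that of the series defining \<open>marginal_filter\<close>,
  so unfolding alone rewrites that series in terms of \<open>torus_char\<close>.\<close>

definition torus_char :: "int^'n \<Rightarrow> real^'n \<Rightarrow> complex" where
  "torus_char k \<xi> = exp (- \<i> * complex_of_real (\<xi> \<bullet> lattice_pt k))"

lemma lattice_pt_add: "lattice_pt (k + l) = lattice_pt k + lattice_pt l"
  and lattice_pt_diff: "lattice_pt (k - l) = lattice_pt k - lattice_pt l"
  and lattice_pt_uminus: "lattice_pt (- k) = - lattice_pt k"
  and lattice_pt_zero: "lattice_pt 0 = 0"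
  by (simp_all add: lattice_pt_def vec_eq_iff)

lemma torus_char_zero [simp]: "torus_char 0 \<xi> = 1"
  by (simp add: torus_char_def lattice_pt_zero)

lemma torus_char_mult: "torus_char k \<xi> * torus_char l \<xi> = torus_char (k + l) \<xi>"
  by (simp add: torus_char_def lattice_pt_add inner_add_right distrib_left exp_add[symmetric])

lemma cnj_torus_char: "cnj (torus_char k \<xi>) = torus_char (- k) \<xi>"
  by (simp add: torus_char_def lattice_pt_uminus exp_cnj)

lemma norm_torus_char [simp]: "cmod (torus_char k \<xi>) = 1"
  by (simp add: torus_char_def)

lemma torus_char_measurable [measurable]: "torus_char k \<in> borel_measurable borel"
  unfolding torus_char_def by (intro borel_measurable_continuous_onI continuous_intros)

text \<open>The inner product of two lattice points is an integer, so the exponent changes by an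
  integral multiple of 2 pi i.\<close>

lemma torus_char_periodic: "torus_char k (\<xi> + (2 * pi) *\<^sub>R lattice_pt l) = torus_char k \<xi>"
proof -
  have "lattice_pt l \<bullet> lattice_pt k = of_int (\<Sum>i\<in>UNIV. l $ i * k $ i)"
    by (simp add: lattice_pt_def inner_vec_def)
  then obtain m :: int where m: "lattice_pt l \<bullet> lattice_pt k = of_int m" by blast
  have "- \<i> * complex_of_real ((\<xi> + (2 * pi) *\<^sub>R lattice_pt l) \<bullet> lattice_pt k)
      = - \<i> * complex_of_real (\<xi> \<bullet> lattice_pt k) + \<i> * (of_int (- m) * (of_real pi * 2))"
    by (simp add: inner_add_left m algebra_simps)
  then show ?thesis unfolding torus_char_def by (simp only: exp_plus_2pin)
qed

abbreviation torus_cell :: "(real^'n) set" where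
  "torus_cell \<equiv> cbox (\<chi> i. - pi) (\<chi> i. pi)"

lemma torus_cell_iff: "\<xi> \<in> torus_cell \<longleftrightarrow> (\<forall>i. - pi \<le> \<xi> $ i \<and> \<xi> $ i \<le> pi)"
  by (simp add: mem_box_cart)

lemma space_period_cell [simp]: "space period_cell = torus_cell"
  by (simp add: period_cell_def space_restrict_space)

lemma finite_measure_period_cell: "finite_measure (period_cell :: (real^'n) measure)"
proof
  show "emeasure period_cell (space (period_cell :: (real^'n) measure)) \<noteq> \<infinity>"
    using emeasure_lborel_cbox_finite[of "\<chi> i. - pi" "\<chi> i. pi :: real^'n"]
    by (simp add: period_cell_def space_restrict_space emeasure_restrict_space)
qed

lemma period_cell_measurable:
  "f \<in> borel_measurable borel \<Longrightarrow> f \<in> borel_measurable period_cell"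
  unfolding period_cell_def by (rule measurable_restrict_space1) simp

lemma nn_integral_period_cell:
  "(\<integral>\<^sup>+x. f x \<partial>period_cell) = (\<integral>\<^sup>+x. f x * indicator torus_cell x \<partial>lborel)"
  unfolding period_cell_def by (rule nn_integral_restrict_space) simp

lemma L2_torus_char: "torus_char k \<in> L2 period_cell"
  unfolding L2_def
  by (auto intro!: period_cell_measurable finite_measure.integrable_const finite_measure_period_cell)

section \<open>Orthogonality of the characters\<close>

text \<open>Lebesgue measure on a Euclidean space is the image of the product measure over
  \<open>Basis\<close>, so Fubini separates the coordinates.\<close>

lemma integral_lborel_prod:
  fixes f :: "'a::euclidean_space \<Rightarrow> real \<Rightarrow> complex"
  assumes "\<And>b. b \<in> Basis \<Longrightarrow> integrable lborel (f b)"
  shows "(LINT x|(lborel :: 'a measure). (\<Prod>b\<in>Basis. f b (x \<bullet> b))) = (\<Prod>b\<in>(Basis::'a set). (LINT t|lborel. f b t))"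
proof -
  interpret product_sigma_finite "\<lambda>_::'a. lborel :: real measure" ..
  have [measurable]: "b \<in> Basis \<Longrightarrow> f b \<in> borel_measurable borel" for b
    using borel_measurable_integrable[OF assms] by simp
  have "(LINT x|(lborel :: 'a measure). (\<Prod>b\<in>Basis. f b (x \<bullet> b)))
      = (LINT y|(\<Pi>\<^sub>M b\<in>(Basis::'a set). lborel). (\<Prod>b\<in>Basis. f b ((\<Sum>b'\<in>Basis. y b' *\<^sub>R b') \<bullet> b)))"
    by (subst lborel_eq, subst integral_distr) measurable
  also have "\<dots> = (LINT y|(\<Pi>\<^sub>M b\<in>(Basis::'a set). lborel). (\<Prod>b\<in>Basis. f b (y b)))"
    by (intro Bochner_Integration.integral_cong refl prod.cong) simp
  also have "\<dots> = (\<Prod>b\<in>(Basis::'a set). (LINT t|lborel. f b t))"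
    by (rule product_integral_prod) (use assms in auto)
  finally show ?thesis .
qed

lemma integral_exp_period:
  fixes m :: int
  defines "g \<equiv> \<lambda>t::real. indicator {-pi..pi} t *\<^sub>R exp (- \<i> * complex_of_real (t * of_int m))"
  shows "integrable lborel g" "(LINT t|lborel. g t) = (if m = 0 then complex_of_real (2 * pi) else 0)"
proof -
  have cont: "continuous_on {-pi..pi} (\<lambda>t. exp (- \<i> * complex_of_real (t * of_int m)))"
    by (intro continuous_intros)
  show "integrable lborel g"
    using borel_integrable_atLeastAtMost'[OF cont] by (simp add: g_def set_integrable_def)
  show "(LINT t|lborel. g t) = (if m = 0 then complex_of_real (2 * pi) else 0)"
  proof (cases "m = 0")
    case True
    have "(LINT t|lborel. g t) = (LINT t|lborel. indicator {-pi..pi} t *\<^sub>R (1::complex))"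
      by (simp add: g_def True)
    also have "\<dots> = complex_of_real (measure lborel {-pi..pi::real})"
      by (subst integral_scaleR_left) (auto simp: scaleR_conv_of_real)
    finally show ?thesis using True by simp
  next
    case False
    define F where "F = (\<lambda>t::real. \<i> / of_int m * exp (- \<i> * complex_of_real (t * of_int m)))"
    have "(LINT t|lborel. g t) = F pi - F (- pi)"
      unfolding g_def
    proof (rule integral_FTC_Icc)
      fix t :: real
      \<comment> \<open>The antiderivative is differentiated in a complex variable and then
        restricted to the real line.\<close>
      have "((\<lambda>z. \<i> / of_int m * exp (- \<i> * (z * of_int m))) has_field_derivative
          exp (- \<i> * (complex_of_real t * of_int m))) (at (complex_of_real t))"
        using False by (auto intro!: derivative_eq_intros)
      from field_vector_diff_chain_at[OF has_vector_derivative_of_real[OF DERIV_ident] this]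
      have "(F has_vector_derivative (of_real 1 * exp (- \<i> * (complex_of_real t * of_int m)))) (at t)"
        unfolding F_def o_def of_real_mult of_real_of_int_eq .
      then show "(F has_vector_derivative exp (- \<i> * complex_of_real (t * of_int m))) (at t within {-pi..pi})"
        unfolding of_real_1 mult_1_left of_real_mult of_real_of_int_eq by (rule has_vector_derivative_at_within)
    qed (use cont in auto)
    \<comment> \<open>The imaginary parts are opposite multiples of sin (m pi) = 0, so the boundary
      values cancel.\<close>
    moreover have "exp (- \<i> * complex_of_real (pi * of_int m)) = exp (- \<i> * complex_of_real (- pi * of_int m))"
      by (rule complex_eqI) (simp_all add: Re_exp Im_exp sin_times_pi_eq_0)
    ultimately show ?thesis using False by (simp add: F_def)
  qed
qed

text \<open>Both the cell and the character factor over the coordinates, and a single coordinate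
  with nonzero frequency makes the product vanish.\<close>

lemma integral_torus_char:
  "(LINT \<xi>|period_cell. torus_char k \<xi>) = (if k = 0 then complex_of_real ((2 * pi) ^ CARD('n)) else 0)"
  for k :: "int^'n"
proof -
  \<comment> \<open>The product over \<open>Basis\<close> is indexed by vectors, not by coordinates;
    the sum recovers k $ i from b = axis i 1.\<close>
  define m where "m b = (\<Sum>i\<in>UNIV. if b = axis i (1::real) then k $ i else 0)" for b :: "real^'n"
  have m_axis: "m (axis i 1) = k $ i" for i by (simp add: m_def axis_eq_axis)
  define g where "g b = (\<lambda>t::real. indicator {-pi..pi} t *\<^sub>R exp (- \<i> * complex_of_real (t * of_int (m b))))" for b
  have prod_axis: "(\<Prod>b\<in>Basis. h b) = (\<Prod>i\<in>UNIV. h (axis i 1))" for h :: "real^'n \<Rightarrow> complex"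
  proof -
    have "bij_betw (\<lambda>i::'n. axis i (1::real)) UNIV Basis"
      by (auto simp: bij_betw_def inj_on_def axis_eq_axis Basis_vec_def)
    from prod.reindex_bij_betw[OF this, of h] show ?thesis by simp
  qed
  have "(LINT \<xi>|period_cell. torus_char k \<xi>) = (LINT \<xi>|lborel. indicator torus_cell \<xi> *\<^sub>R torus_char k \<xi>)"
    unfolding period_cell_def by (rule integral_restrict_space) simp
  also have "\<dots> = (LINT \<xi>|lborel. (\<Prod>b\<in>Basis. g b (\<xi> \<bullet> b)))"
  proof (rule Bochner_Integration.integral_cong[OF refl])
    fix \<xi> :: "real^'n"
    have "(\<Prod>i\<in>UNIV. indicator {-pi..pi} (\<xi> $ i) :: complex) = indicator torus_cell \<xi>"
      unfolding indicator_def torus_cell_iff by (auto simp: prod_zero_iff)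
    moreover have "(\<Prod>i\<in>UNIV. exp (- \<i> * complex_of_real (\<xi> $ i * of_int (k $ i)))) = torus_char k \<xi>"
      by (simp add: exp_sum[symmetric] torus_char_def inner_vec_def lattice_pt_def sum_distrib_left sum_negf)
    ultimately have "(\<Prod>i\<in>UNIV. indicator {-pi..pi} (\<xi> $ i) * exp (- \<i> * complex_of_real (\<xi> $ i * of_int (k $ i))))
        = indicator torus_cell \<xi> * torus_char k \<xi>"
      by (simp only: prod.distrib)
    moreover have "(\<Prod>b\<in>Basis. g b (\<xi> \<bullet> b))
        = (\<Prod>i\<in>UNIV. indicator {-pi..pi} (\<xi> $ i) * exp (- \<i> * complex_of_real (\<xi> $ i * of_int (k $ i))))"
      unfolding prod_axis by (intro prod.cong refl) (auto simp: g_def m_axis inner_axis indicator_def)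
    ultimately show "indicator torus_cell \<xi> *\<^sub>R torus_char k \<xi> = (\<Prod>b\<in>Basis. g b (\<xi> \<bullet> b))"
      by (auto simp: indicator_def)
  qed
  also have "\<dots> = (\<Prod>b\<in>Basis. (LINT t|lborel. g b t))"
    by (rule integral_lborel_prod) (unfold g_def, rule integral_exp_period)
  also have "\<dots> = (\<Prod>i\<in>(UNIV::'n set). if k $ i = 0 then complex_of_real (2 * pi) else 0)"
    unfolding prod_axis g_def integral_exp_period(2) m_axis ..
  also have "\<dots> = (if k = 0 then complex_of_real ((2 * pi) ^ CARD('n)) else 0)"
    by (auto simp: vec_eq_iff prod_zero_iff)
  finally show ?thesis .
qed

lemma torus_char_orthogonal:
  "L2_inner period_cell (torus_char k) (torus_char l) =
     (if k = l then complex_of_real ((2 * pi) ^ CARD('n)) else 0)"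
  for k l :: "int^'n"
  unfolding L2_inner_def cnj_torus_char torus_char_mult using integral_torus_char[of "k + - l"]
  by (simp add: add_eq_0_iff)

section \<open>Uniqueness of Fourier coefficients\<close>

lemma Arg_measurable [measurable]: "Arg \<in> borel_measurable borel"
proof -
  \<comment> \<open>\<open>Arg\<close> is continuous off the closed negative half-line, equals pi on
    that half-line away from 0, and is 0 at 0, where both summands vanish.\<close>
  have eq: "Arg z = indicator (- \<real>\<^sub>\<le>\<^sub>0) z *\<^sub>R Arg z + indicator (\<real>\<^sub>\<le>\<^sub>0 - {0}) z * pi" for z
  proof (cases "z = 0")
    case False
    then show ?thesis by (auto simp: indicator_def Arg_eq_pi complex_nonpos_Reals_iff complex_eq_iff)
  qed (simp add: Arg_zero)
  have "(\<lambda>z. indicator (- \<real>\<^sub>\<le>\<^sub>0) z *\<^sub>R Arg z) \<in> borel_measurable borel"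
    by (intro borel_measurable_continuous_on_indicator continuous_at_imp_continuous_on ballI continuous_at_Arg)
      auto
  moreover have "(\<real>\<^sub>\<le>\<^sub>0 - {0} :: complex set) \<in> sets borel"
    by (intro sets.Diff borel_closed) auto
  then have "(\<lambda>z::complex. indicator (\<real>\<^sub>\<le>\<^sub>0 - {0}) z * pi) \<in> borel_measurable borel"
    by (intro borel_measurable_times borel_measurable_indicator) auto
  ultimately have "(\<lambda>z. indicator (- \<real>\<^sub>\<le>\<^sub>0) z *\<^sub>R Arg z + indicator (\<real>\<^sub>\<le>\<^sub>0 - {0}) z * pi) \<in> borel_measurable borel"
    by (intro borel_measurable_add)
  then show ?thesis by (simp only: eq[symmetric])
qed

text \<open>The sets where \<open>u\<close> is positive and where it is negative isolate the
  integrals of its positive and negative parts.\<close>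

lemma AE_zero_of_set_integrals_real:
  fixes u :: "'a \<Rightarrow> real"
  assumes u: "integrable M u"
    and z: "\<And>D. D \<in> sets M \<Longrightarrow> (LINT x|M. u x * indicator D x) = 0"
  shows "AE x in M. u x = 0"
proof -
  have [measurable]: "u \<in> borel_measurable M" using u by simp
  have "(LINT x|M. max 0 (u x)) = (LINT x|M. u x * indicator {x \<in> space M. u x > 0} x)"
    by (intro Bochner_Integration.integral_cong) (auto simp: indicator_def)
  also have "\<dots> = 0" by (intro z) measurable
  finally have "AE x in M. max 0 (u x) = 0"
    using u by (subst (asm) integral_nonneg_eq_0_iff_AE) auto
  moreover have "(LINT x|M. max 0 (- u x)) = - (LINT x|M. u x * indicator {x \<in> space M. u x < 0} x)"
    unfolding Bochner_Integration.integral_minus[symmetric]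
    by (intro Bochner_Integration.integral_cong) (auto simp: indicator_def)
  then have "(LINT x|M. max 0 (- u x)) = 0" by (subst (asm) z) auto
  then have "AE x in M. max 0 (- u x) = 0"
    using u by (subst (asm) integral_nonneg_eq_0_iff_AE) auto
  ultimately show ?thesis by eventually_elim (auto simp: max_def split: if_splits)
qed

lemma AE_zero_of_set_integrals:
  fixes h :: "'a \<Rightarrow> complex"
  assumes h: "integrable M h"
    and z: "\<And>D. D \<in> sets M \<Longrightarrow> (LINT x|M. h x * indicator D x) = 0"
  shows "AE x in M. h x = 0"
proof -
  have ih: "integrable M (\<lambda>x. h x * indicator D x)" if "D \<in> sets M" for D
    using integrable_mult_indicator[OF that h] by (simp add: scaleR_conv_of_real mult.commute of_real_indicator)
  have "AE x in M. Re (h x) = 0"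
  proof (rule AE_zero_of_set_integrals_real)
    fix D assume D: "D \<in> sets M"
    have "(LINT x|M. Re (h x) * indicator D x) = (LINT x|M. Re (h x * indicator D x))"
      by (intro Bochner_Integration.integral_cong) (auto simp: indicator_def)
    also have "\<dots> = 0" using z[OF D] by (subst integral_Re[OF ih[OF D]]) simp
    finally show "(LINT x|M. Re (h x) * indicator D x) = 0" .
  qed (use h in simp)
  moreover have "AE x in M. Im (h x) = 0"
  proof (rule AE_zero_of_set_integrals_real)
    fix D assume D: "D \<in> sets M"
    have "(LINT x|M. Im (h x) * indicator D x) = (LINT x|M. Im (h x * indicator D x))"
      by (intro Bochner_Integration.integral_cong) (auto simp: indicator_def)
    also have "\<dots> = 0" using z[OF D] by (subst integral_Im[OF ih[OF D]]) simp
    finally show "(LINT x|M. Im (h x) * indicator D x) = 0" .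
  qed (use h in simp)
  ultimately show ?thesis by eventually_elim (simp add: complex_eq_iff)
qed

text \<open>Indicators of closed sets are decreasing limits of continuous functions, and closed sets
  generate the Borel sets.\<close>

lemma integral_indicator_zero_of_continuous:
  fixes E :: "'a \<Rightarrow> 'b::euclidean_space" and h :: "'a \<Rightarrow> complex"
  assumes h: "integrable M h" and E [measurable]: "E \<in> borel_measurable M"
    and z: "\<And>F :: 'b \<Rightarrow> real. continuous_on UNIV F \<Longrightarrow> (\<And>z. \<bar>F z\<bar> \<le> 1) \<Longrightarrow>
      (LINT x|M. h x * of_real (F (E x))) = 0"
    and D: "D \<in> sets borel"
  shows "(LINT x|M. h x * indicator D (E x)) = 0"
proof -
  have [measurable]: "h \<in> borel_measurable M" using h by simp
  \<comment> \<open>The constant test function; this value is what complements require in the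
    induction over Borel sets below.\<close>
  have h0: "(LINT x|M. h x) = 0"
    using z[of "\<lambda>_. 1"] by simp
  have ih: "integrable M (\<lambda>x. h x * indicator D (E x))" if [measurable]: "D \<in> sets borel" for D
    by (rule Bochner_Integration.integrable_bound[OF h]) (auto simp: indicator_def)
  have closed: "(LINT x|M. h x * indicator C (E x)) = 0" if C: "closed C" for C
  proof (cases "C = {}")
    case False
    \<comment> \<open>A continuous function equal to 1 on C and to 0 at distance at least 1/j from
      C, for positive j.\<close>
    define F where "F j z = max 0 (1 - real j * infdist z C)" for j z
    have F_cont: "continuous_on UNIV (F j)" for j
      unfolding F_def by (intro continuous_intros)
    have F_bd: "\<bar>F j z\<bar> \<le> 1" for j z
      using infdist_nonneg[of z C] by (auto simp: F_def max_def)
    have lim: "(\<lambda>j. F j z) \<longlonglongrightarrow> indicator C z" for z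
    proof (cases "z \<in> C")
      case True
      then have "F j z = 1" for j using in_closed_iff_infdist_zero[OF C False] by (simp add: F_def)
      then show ?thesis using True by simp
    next
      case False
      then have "infdist z C > 0"
        using in_closed_iff_infdist_zero[OF C \<open>C \<noteq> {}\<close>] infdist_nonneg[of z C] by fastforce
      then obtain N :: nat where N: "1 < real N * infdist z C"
        using reals_Archimedean3 by blast
      have "F j z = 0" if "j \<ge> N" for j
      proof -
        have "real N * infdist z C \<le> real j * infdist z C"
          using that infdist_nonneg by (intro mult_right_mono) auto
        with N show ?thesis by (simp add: F_def)
      qed
      then have "eventually (\<lambda>j. F j z = indicator C z) sequentially"
        using False by (auto simp: eventually_sequentially)
      then show ?thesis by (rule tendsto_eventually)
    qed
    have [measurable]: "F j \<in> borel_measurable borel" for j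
      by (intro borel_measurable_continuous_onI F_cont)
    have [measurable]: "C \<in> sets borel" using C by simp
    have "(\<lambda>j. LINT x|M. h x * of_real (F j (E x))) \<longlonglongrightarrow> (LINT x|M. h x * indicator C (E x))"
    proof (rule integral_dominated_convergence[where w = "\<lambda>x. cmod (h x)"])
      have "(\<lambda>j. h x * of_real (F j (E x))) \<longlonglongrightarrow> h x * of_real (indicator C (E x))" for x
        by (intro tendsto_intros lim)
      then show "AE x in M. (\<lambda>j. h x * of_real (F j (E x))) \<longlonglongrightarrow> h x * indicator C (E x)"
        by (simp add: of_real_indicator)
      have "cmod (h x * of_real (F j (E x))) \<le> cmod (h x)" for j x
        using F_bd[of j "E x"] mult_left_mono[of "\<bar>F j (E x)\<bar>" 1 "cmod (h x)"] by (simp add: norm_mult)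
      then show "AE x in M. norm (h x * of_real (F j (E x))) \<le> cmod (h x)" for j by simp
    qed (use h in \<open>auto intro!: borel_measurable_times\<close>)
    moreover have "(LINT x|M. h x * of_real (F j (E x))) = 0" for j
      by (rule z[OF F_cont F_bd])
    ultimately show ?thesis by (simp add: LIMSEQ_const_iff)
  qed simp
  \<comment> \<open>Closed sets form a generator stable under intersection, so it suffices to close
    the property under complements and countable disjoint unions.\<close>
  have "Int_stable (Collect closed :: 'b set set)" by (auto simp: Int_stable_def)
  moreover have "Collect closed \<subseteq> Pow (UNIV :: 'b set)" by simp
  moreover have "D \<in> sigma_sets UNIV (Collect closed)" using D by (simp add: borel_eq_closed)
  ultimately show ?thesis
  proof (induction rule: sigma_sets_induct_disjoint)
    case (basic A) then show ?case by (intro closed) simp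
  next
    case empty show ?case by simp
  next
    case (compl A)
    then have "A \<in> sets borel" by (simp add: borel_eq_closed)
    have "(LINT x|M. h x * indicator (UNIV - A) (E x)) = (LINT x|M. h x - h x * indicator A (E x))"
      by (intro Bochner_Integration.integral_cong) (auto simp: indicator_def)
    also have "\<dots> = 0"
      using compl h0 by (subst Bochner_Integration.integral_diff[OF h ih[OF \<open>A \<in> sets borel\<close>]]) simp
    finally show ?case .
  next
    case (union A)
    then have A [measurable]: "A i \<in> sets borel" for i by (auto simp: borel_eq_closed)
    have "(\<lambda>n. LINT x|M. h x * indicator (\<Union>i<n. A i) (E x)) \<longlonglongrightarrow> (LINT x|M. h x * indicator (\<Union>i. A i) (E x))"
    proof (rule integral_dominated_convergence[where w = "\<lambda>x. cmod (h x)"])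
      have "(\<lambda>n. h x * indicator (\<Union>i<n. A i) (E x)) \<longlonglongrightarrow> h x * indicator (\<Union>i. A i) (E x)" for x
        by (intro tendsto_mult tendsto_const LIMSEQ_indicator_UN)
      then show "AE x in M. (\<lambda>n. h x * indicator (\<Union>i<n. A i) (E x)) \<longlonglongrightarrow> h x * indicator (\<Union>i. A i) (E x)"
        by simp
      show "AE x in M. norm (h x * indicator (\<Union>i<n. A i) (E x)) \<le> cmod (h x)" for n
        by (auto simp: indicator_def)
      show "(\<lambda>x. h x * indicator (\<Union>i. A i) (E x)) \<in> borel_measurable M"
        by (intro borel_measurable_integrable ih sets.countable_UN) (auto intro: A)
      show "(\<lambda>x. h x * indicator (\<Union>i<n. A i) (E x)) \<in> borel_measurable M" for n
        by (intro borel_measurable_integrable ih sets.finite_UN) (auto intro: A)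
    qed (use h in auto)
    moreover have "(LINT x|M. h x * indicator (\<Union>i<n. A i) (E x)) = 0" for n
    proof -
      have "(LINT x|M. h x * indicator (\<Union>i<n. A i) (E x)) = (LINT x|M. (\<Sum>i<n. h x * indicator (A i) (E x)))"
      proof (rule Bochner_Integration.integral_cong[OF refl])
        fix x
        have "(indicator (\<Union>i<n. A i) (E x) :: complex) = (\<Sum>i<n. indicator (A i) (E x))"
          by (rule indicator_UN_disjoint) (use union in \<open>auto intro: disjoint_family_on_mono\<close>)
        then show "h x * indicator (\<Union>i<n. A i) (E x) = (\<Sum>i<n. h x * indicator (A i) (E x))"
          by (simp add: sum_distrib_left)
      qed
      also have "\<dots> = 0"
        by (subst Bochner_Integration.integral_sum) (auto simp: union ih A)
      finally show ?thesis .
    qed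
    ultimately show ?case by (simp add: LIMSEQ_const_iff)
  qed
qed

text \<open>The torus is embedded in \<open>complex^'n\<close>, where the Stone-Weierstrass theorem for polynomial
  functions is available; polynomials in \<open>cos (\<xi> $ i)\<close> and \<open>sin (\<xi> $ i)\<close> are trigonometric
  polynomials.\<close>

definition torus_embed :: "real^'n \<Rightarrow> complex^'n" where
  "torus_embed \<xi> = (\<chi> i. cis (\<xi> $ i))"

lemma torus_embed_continuous: "continuous_on S torus_embed"
  unfolding torus_embed_def by (intro continuous_intros)

text \<open>Euler's formulas for cosine and sine. Since \<open>torus_char (\<delta> i)\<close> is
  cis (- \<xi> $ i), the sine has coefficient i/2 on it and -i/2 on its conjugate.\<close>

lemma torus_embed_coordinates:
  defines "\<delta> \<equiv> \<lambda>i. axis i (1::int) :: int^'n"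
  assumes "b \<in> Basis"
  obtains i c d where "\<And>\<xi> :: real^'n. complex_of_real (torus_embed \<xi> \<bullet> b)
    = c * torus_char (\<delta> i) \<xi> + d * torus_char (- \<delta> i) \<xi>"
proof -
  have lp: "lattice_pt (\<delta> i) = axis i 1" for i
    by (simp add: lattice_pt_def \<delta>_def vec_eq_iff axis_def)
  have ch: "torus_char (\<delta> i) \<xi> = cis (- (\<xi> $ i))" "torus_char (- \<delta> i) \<xi> = cis (\<xi> $ i)" for i and \<xi> :: "real^'n"
    by (simp_all add: torus_char_def lattice_pt_uminus lp inner_axis cis_conv_exp)
  obtain i u where b: "b = axis i u" and "u \<in> Basis"
    using assms(2) by (auto simp: Basis_vec_def)
  then consider "u = 1" | "u = \<i>" by (auto simp: Basis_complex_def)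
  then show ?thesis
  proof cases
    case 1
    have "complex_of_real (torus_embed \<xi> \<bullet> b) = 1/2 * torus_char (\<delta> i) \<xi> + 1/2 * torus_char (- \<delta> i) \<xi>" for \<xi>
      by (simp add: b 1 inner_axis torus_embed_def ch complex_eq_iff)
    then show ?thesis by (rule that)
  next
    case 2
    have "complex_of_real (torus_embed \<xi> \<bullet> b) = \<i>/2 * torus_char (\<delta> i) \<xi> + (-\<i>/2) * torus_char (- \<delta> i) \<xi>" for \<xi>
      by (simp add: b 2 inner_axis torus_embed_def ch complex_eq_iff)
    then show ?thesis by (rule that)
  qed
qed

section \<open>Integrable functions with vanishing Fourier coefficients\<close>

context
  fixes h :: "real^'n \<Rightarrow> complex"
  assumes h_int: "integrable period_cell h"
    and h_coeff: "\<And>k. (LINT \<xi>|period_cell. h \<xi> * torus_char k \<xi>) = 0"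
begin

text \<open>Requiring every Fourier coefficient of h g to vanish, and not merely its integral, makes
  this class stable under multiplication by characters. Boundedness of g keeps h g
  integrable.\<close>

definition annihilated :: "(real^'n \<Rightarrow> complex) \<Rightarrow> bool" where
  "annihilated g \<longleftrightarrow> g \<in> borel_measurable borel \<and> (\<exists>C. \<forall>\<xi>. cmod (g \<xi>) \<le> C) \<and>
     (\<forall>k. (LINT \<xi>|period_cell. h \<xi> * (g \<xi> * torus_char k \<xi>)) = 0)"

lemma integrable_mult_bounded:
  assumes "g \<in> borel_measurable borel" "\<And>\<xi>. cmod (g \<xi>) \<le> C"
  shows "integrable period_cell (\<lambda>\<xi>. h \<xi> * g \<xi>)"
proof (rule Bochner_Integration.integrable_bound)
  show "integrable period_cell (\<lambda>\<xi>. C * cmod (h \<xi>))" using h_int by simp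
  show "(\<lambda>\<xi>. h \<xi> * g \<xi>) \<in> borel_measurable period_cell"
    by (rule borel_measurable_times[OF borel_measurable_integrable[OF h_int] period_cell_measurable[OF assms(1)]])
  have "cmod (h \<xi> * g \<xi>) \<le> norm (C * cmod (h \<xi>))" for \<xi>
    using mult_right_mono[OF assms(2)[of \<xi>] norm_ge_zero[of "h \<xi>"]] order_trans[OF norm_ge_zero assms(2)[of \<xi>]]
    by (simp add: norm_mult abs_mult mult.commute)
  then show "AE \<xi> in period_cell. norm (h \<xi> * g \<xi>) \<le> norm (C * cmod (h \<xi>))" by simp
qed

lemma annihilated_integrable:
  assumes "annihilated g" shows "integrable period_cell (\<lambda>\<xi>. h \<xi> * (g \<xi> * torus_char k \<xi>))"
  using assms unfolding annihilated_def
  by (auto intro!: integrable_mult_bounded simp: norm_mult)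

lemma annihilated_one: "annihilated (\<lambda>\<xi>. 1)"
  unfolding annihilated_def using h_coeff by (auto intro: exI[of _ 1])

lemma annihilated_cmult: assumes "annihilated g" shows "annihilated (\<lambda>\<xi>. c * g \<xi>)"
proof -
  obtain C where C: "\<And>\<xi>. cmod (g \<xi>) \<le> C" using assms by (auto simp: annihilated_def)
  have "(LINT \<xi>|period_cell. h \<xi> * (c * g \<xi> * torus_char k \<xi>)) = 0" for k
  proof -
    have "(LINT \<xi>|period_cell. h \<xi> * (c * g \<xi> * torus_char k \<xi>))
        = (LINT \<xi>|period_cell. c * (h \<xi> * (g \<xi> * torus_char k \<xi>)))"
      by (simp only: ac_simps)
    then show ?thesis using assms by (simp add: annihilated_def)
  qed
  then show ?thesis
    using assms C unfolding annihilated_def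
    by (auto simp: norm_mult intro!: exI[of _ "cmod c * C"] mult_left_mono)
qed

lemma annihilated_add:
  assumes f: "annihilated f" and g: "annihilated g" shows "annihilated (\<lambda>\<xi>. f \<xi> + g \<xi>)"
proof -
  obtain C where C: "\<And>\<xi>. cmod (f \<xi>) \<le> C" using f by (auto simp: annihilated_def)
  obtain D where D: "\<And>\<xi>. cmod (g \<xi>) \<le> D" using g by (auto simp: annihilated_def)
  have "(LINT \<xi>|period_cell. h \<xi> * ((f \<xi> + g \<xi>) * torus_char k \<xi>)) = 0" for k
    using f g Bochner_Integration.integral_add[OF annihilated_integrable[OF f] annihilated_integrable[OF g], of k k]
    by (simp add: algebra_simps annihilated_def)
  moreover have "cmod (f \<xi> + g \<xi>) \<le> C + D" for \<xi> by (intro norm_triangle_mono C D)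
  ultimately show ?thesis using f g unfolding annihilated_def by auto
qed

lemma annihilated_torus_char_mult: assumes "annihilated g" shows "annihilated (\<lambda>\<xi>. torus_char l \<xi> * g \<xi>)"
proof -
  have "torus_char l \<xi> * g \<xi> * torus_char k \<xi> = g \<xi> * torus_char (l + k) \<xi>" for \<xi> k
    unfolding torus_char_mult[symmetric] by (simp only: ac_simps)
  then have "(LINT \<xi>|period_cell. h \<xi> * (torus_char l \<xi> * g \<xi> * torus_char k \<xi>)) = 0" for k
    using assms by (simp only: annihilated_def)
  then show ?thesis using assms unfolding annihilated_def by (auto simp: norm_mult)
qed

lemma annihilated_sum:
  "finite I \<Longrightarrow> (\<And>i. i \<in> I \<Longrightarrow> annihilated (f i)) \<Longrightarrow> annihilated (\<lambda>\<xi>. \<Sum>i\<in>I. f i \<xi>)"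
proof (induction rule: finite_induct)
  case empty
  show ?case using annihilated_cmult[OF annihilated_one, of 0] by simp
qed (auto intro: annihilated_add)

text \<open>The factor \<open>g\<close> is kept general so that the case of a product follows by
  applying the two induction hypotheses one after the other. A linear function is expanded in
  coordinates, each a combination of two characters.\<close>

lemma annihilated_polynomial:
  assumes "real_polynomial_function p" "annihilated g"
  shows "annihilated (\<lambda>\<xi>. of_real (p (torus_embed \<xi>)) * g \<xi>)"
  using assms
proof (induction arbitrary: g rule: real_polynomial_function.induct)
  case (linear f)
  note lf = bounded_linear.linear[OF linear(1)]
  have f_eq: "f z = (\<Sum>b\<in>Basis. f b * (z \<bullet> b))" for z
  proof -
    have "f z = f (\<Sum>b\<in>Basis. (z \<bullet> b) *\<^sub>R b)" by (simp only: euclidean_representation)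
    also have "\<dots> = (\<Sum>b\<in>Basis. f ((z \<bullet> b) *\<^sub>R b))" by (rule linear_sum[OF lf])
    also have "\<dots> = (\<Sum>b\<in>Basis. f b * (z \<bullet> b))"
      by (intro sum.cong refl) (simp only: linear_cmul[OF lf] real_scaleR_def mult.commute)
    finally show ?thesis .
  qed
  have "(\<lambda>\<xi>. of_real (f (torus_embed \<xi>)) * g \<xi>)
      = (\<lambda>\<xi>. \<Sum>b\<in>Basis. of_real (f b) * (of_real (torus_embed \<xi> \<bullet> b) * g \<xi>))"
    by (rule ext, subst f_eq) (simp only: of_real_sum of_real_mult sum_distrib_right mult.assoc)
  moreover have "annihilated (\<lambda>\<xi>. of_real (torus_embed \<xi> \<bullet> b) * g \<xi>)" if b: "b \<in> Basis" for b
  proof -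
    obtain i c d where eq: "\<And>\<xi>. complex_of_real (torus_embed \<xi> \<bullet> b)
        = c * torus_char (axis i 1) \<xi> + d * torus_char (- axis i 1) \<xi>"
      by (rule torus_embed_coordinates[OF b]) blast
    show ?thesis
      unfolding eq distrib_right mult.assoc
      by (intro annihilated_add annihilated_cmult annihilated_torus_char_mult linear(2))
  qed
  then have "annihilated (\<lambda>\<xi>. \<Sum>b\<in>Basis. of_real (f b) * (of_real (torus_embed \<xi> \<bullet> b) * g \<xi>))"
    by (intro annihilated_sum annihilated_cmult finite_Basis)
  ultimately show ?case by (simp only:)
next
  case (const c)
  then show ?case by (rule annihilated_cmult)
next
  case (add f f')
  from annihilated_add[OF add.IH(1)[OF add.prems] add.IH(2)[OF add.prems]]
  show ?case unfolding of_real_add distrib_right .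
next
  case (mult f f')
  from mult.IH(1)[OF mult.IH(2)[OF mult.prems]]
  show ?case unfolding of_real_mult mult.assoc .
qed

text \<open>On the compact image of the cell, \<open>F\<close> is uniformly approximated by a
  polynomial, whose integral against \<open>h\<close> vanishes; the error is at most \<epsilon>
  times the integral of |h|.\<close>

lemma integral_continuous_zero:
  fixes F :: "complex^'n \<Rightarrow> real"
  assumes F: "continuous_on UNIV F" and F1: "\<And>z. \<bar>F z\<bar> \<le> 1"
  shows "(LINT \<xi>|period_cell. h \<xi> * of_real (F (torus_embed \<xi>))) = 0"
proof -
  let ?S = "torus_embed ` torus_cell"
  define H where "H = (LINT \<xi>|period_cell. cmod (h \<xi>))"
  have H: "0 \<le> H" by (simp add: H_def)
  have S: "compact ?S" by (intro compact_continuous_image torus_embed_continuous compact_cbox)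
  have FE: "(\<lambda>\<xi>. complex_of_real (F (torus_embed \<xi>))) \<in> borel_measurable borel"
    by (intro borel_measurable_continuous_onI continuous_intros continuous_on_compose2[OF F] torus_embed_continuous) auto
  have iF: "integrable period_cell (\<lambda>\<xi>. h \<xi> * of_real (F (torus_embed \<xi>)))"
    by (rule integrable_mult_bounded[OF FE, of 1]) (simp add: F1)
  have "cmod (LINT \<xi>|period_cell. h \<xi> * of_real (F (torus_embed \<xi>))) \<le> \<epsilon> * H" if \<epsilon>: "\<epsilon> > 0" for \<epsilon>
  proof -
    obtain p where p: "real_polynomial_function p" "\<And>z. z \<in> ?S \<Longrightarrow> \<bar>F z - p z\<bar> < \<epsilon>"
      by (rule Stone_Weierstrass_real_polynomial_function[OF S continuous_on_subset[OF F subset_UNIV] \<epsilon>]) blast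
    have ann: "annihilated (\<lambda>\<xi>. of_real (p (torus_embed \<xi>)))"
      using annihilated_polynomial[OF p(1) annihilated_one] by simp
    have ip: "integrable period_cell (\<lambda>\<xi>. h \<xi> * of_real (p (torus_embed \<xi>)))"
      using annihilated_integrable[OF ann, of 0] by simp
    have "(LINT \<xi>|period_cell. h \<xi> * of_real (p (torus_embed \<xi>))) = 0"
      using ann unfolding annihilated_def by (auto dest: spec[of _ 0])
    then have "(LINT \<xi>|period_cell. h \<xi> * of_real (F (torus_embed \<xi>)))
        = (LINT \<xi>|period_cell. h \<xi> * of_real (F (torus_embed \<xi>)) - h \<xi> * of_real (p (torus_embed \<xi>)))"
      using iF ip by simp
    also have "cmod \<dots> \<le> (LINT \<xi>|period_cell. \<epsilon> * cmod (h \<xi>))"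
    proof (rule order_trans[OF integral_norm_bound integral_mono])
      fix \<xi> :: "real^'n" assume "\<xi> \<in> space period_cell"
      then have "\<bar>F (torus_embed \<xi>) - p (torus_embed \<xi>)\<bar> \<le> \<epsilon>" by (intro less_imp_le p(2)) simp
      then have "cmod (of_real (F (torus_embed \<xi>) - p (torus_embed \<xi>))) \<le> \<epsilon>" by (simp only: norm_of_real)
      from mult_right_mono[OF this norm_ge_zero[of "h \<xi>"]]
      show "cmod (h \<xi> * of_real (F (torus_embed \<xi>)) - h \<xi> * of_real (p (torus_embed \<xi>))) \<le> \<epsilon> * cmod (h \<xi>)"
        by (simp add: right_diff_distrib[symmetric] norm_mult mult.commute)
    qed (use iF ip h_int in auto)
    finally show ?thesis by (simp add: H_def)
  qed
  note bd = this
  have "cmod (LINT \<xi>|period_cell. h \<xi> * of_real (F (torus_embed \<xi>))) \<le> 0 + e" if "e > 0" for e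
  proof -
    \<comment> \<open>The denominator is H + 1 because H may be 0.\<close>
    have "e / (H + 1) * H \<le> e" using that H by (simp add: field_simps)
    then show ?thesis using bd[of "e / (H + 1)"] that H by auto
  qed
  then have "cmod (LINT \<xi>|period_cell. h \<xi> * of_real (F (torus_embed \<xi>))) \<le> 0"
    by (rule field_le_epsilon)
  then show ?thesis by simp
qed

text \<open>The previous results test \<open>h\<close> only on sets pulled back through
  \<open>torus_embed\<close>. A Borel map inverting the embedding almost everywhere on the cell
  shows that every Borel subset of the cell is such a set up to a null set.\<close>

lemma Fourier_coefficients_unique:
  "AE \<xi> in period_cell. h \<xi> = 0"
proof (rule AE_zero_of_set_integrals[OF h_int])
  fix D :: "(real^'n) set" assume "D \<in> sets period_cell"
  then obtain D' where D': "D' \<in> sets borel" "D = D' \<inter> torus_cell"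
    by (auto simp: period_cell_def sets_restrict_space)
  define G where "G z = (\<chi> i. Arg (z $ i))" for z :: "complex^'n"
  have G: "G \<in> borel_measurable borel"
  proof (subst borel_measurable_euclidean_space, rule ballI)
    fix b :: "real^'n" assume "b \<in> Basis"
    then obtain i where "b = axis i 1" by (auto simp: Basis_vec_def)
    moreover have "(\<lambda>z::complex^'n. z $ i) \<in> borel_measurable borel"
      by (intro borel_measurable_continuous_onI continuous_intros)
    ultimately show "(\<lambda>z. G z \<bullet> b) \<in> borel_measurable borel"
      by (simp add: G_def inner_axis)
  qed
  have E: "torus_embed \<in> borel_measurable period_cell"
    by (intro period_cell_measurable borel_measurable_continuous_onI torus_embed_continuous)
  \<comment> \<open>\<open>Arg\<close> takes values in ]-pi, pi], so inversion fails only on the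
    faces of the cell with a coordinate equal to -pi; hyperplanes are null.\<close>
  have null: "AE \<xi> in lborel. \<xi> $ i \<noteq> - pi" for i :: 'n
  proof -
    have "{\<xi> :: real^'n. \<xi> $ i = - pi} \<in> null_sets lebesgue"
      using negligible_standard_hyperplane[of "axis i 1 :: real^'n" "- pi"]
      by (simp add: negligible_iff_null_sets inner_axis)
    then have "AE \<xi> in lebesgue. \<xi> \<notin> {\<xi> :: real^'n. \<xi> $ i = - pi}" by (rule AE_not_in)
    then show ?thesis by (simp add: AE_completion_iff)
  qed
  then have "AE \<xi> in lborel. \<forall>i::'n. \<xi> $ i \<noteq> - pi" by (simp add: AE_all_countable)
  then have "AE \<xi> in lborel. \<xi> \<in> torus_cell \<longrightarrow> G (torus_embed \<xi>) = \<xi>"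
  proof eventually_elim
    case (elim \<xi>)
    have "Arg (cis (\<xi> $ i)) = \<xi> $ i" if "\<xi> \<in> torus_cell" for i
      using that elim by (intro Arg_cis) (metis greaterThanAtMost_iff order_less_le torus_cell_iff)
    then show ?case by (auto simp: G_def torus_embed_def vec_eq_iff)
  qed
  then have inv: "AE \<xi> in period_cell. G (torus_embed \<xi>) = \<xi>"
    unfolding period_cell_def by (subst AE_restrict_space_iff) auto
  have "G -` D' \<in> sets borel" using measurable_sets[OF G D'(1)] by simp
  then have "(LINT \<xi>|period_cell. h \<xi> * indicator (G -` D') (torus_embed \<xi>)) = 0"
    by (intro integral_indicator_zero_of_continuous[OF h_int E integral_continuous_zero])
  also have "(LINT \<xi>|period_cell. h \<xi> * indicator (G -` D') (torus_embed \<xi>)) = (LINT \<xi>|period_cell. h \<xi> * indicator D \<xi>)"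
  proof (rule integral_cong_AE)
    show "AE \<xi> in period_cell. h \<xi> * indicator (G -` D') (torus_embed \<xi>) = h \<xi> * indicator D \<xi>"
      using inv AE_space by eventually_elim (auto simp: indicator_def D')
    have "h \<in> borel_measurable period_cell" using h_int by simp
    moreover have "D \<in> sets period_cell" by fact
    ultimately show "(\<lambda>\<xi>. h \<xi> * indicator D \<xi>) \<in> borel_measurable period_cell" by measurable
    show "(\<lambda>\<xi>. h \<xi> * indicator (G -` D') (torus_embed \<xi>)) \<in> borel_measurable period_cell"
      using \<open>h \<in> borel_measurable period_cell\<close> E \<open>G -` D' \<in> sets borel\<close>
      by (intro borel_measurable_times measurable_compose[OF E borel_measurable_indicator])
  qed
  finally show "(LINT \<xi>|period_cell. h \<xi> * indicator D \<xi>) = 0" .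
qed

end

section \<open>Integer matrices acting on the torus\<close>

lemma int_matrix_lattice_pt:
  fixes M :: "real^'n^'n"
  assumes "\<And>i j. M $ i $ j \<in> \<int>"
  obtains \<mu> where "\<And>k. lattice_pt (\<mu> k) = M *v lattice_pt k"
proof -
  \<comment> \<open>The entries are already integers; the floor only changes their type.\<close>
  have "lattice_pt (\<chi> i. \<lfloor>(M *v lattice_pt k) $ i\<rfloor>) = M *v lattice_pt k" for k
  proof -
    have "(M *v lattice_pt k) $ i \<in> \<int>" for i
      unfolding matrix_vector_mult_def lattice_pt_def by (auto intro!: assms Ints_mult Ints_sum)
    then show ?thesis by (simp add: lattice_pt_def vec_eq_iff)
  qed
  then show ?thesis by (rule that)
qed

text \<open>Here symmetry enters: \<open>M\<close> moves across the inner product onto the frequency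
  without becoming its transpose.\<close>

lemma torus_char_matrix:
  assumes "Finite_Cartesian_Product.transpose M = M" "lattice_pt l = M *v lattice_pt k"
  shows "torus_char k (M *v \<xi>) = torus_char l \<xi>"
proof -
  have "(M *v \<xi>) \<bullet> lattice_pt k = \<xi> \<bullet> (M *v lattice_pt k)"
    using transpose_matrix_vector[of M \<xi>] by (simp add: assms(1) dot_lmul_matrix)
  then show ?thesis by (simp add: torus_char_def assms(2))
qed

definition nearest_lattice :: "real^'n \<Rightarrow> int^'n" where
  "nearest_lattice \<eta> = (\<chi> i. round (\<eta> $ i / (2 * pi)))"

lemma nearest_lattice: "\<eta> - (2 * pi) *\<^sub>R lattice_pt (nearest_lattice \<eta>) \<in> torus_cell"
proof -
  have "\<bar>\<eta> $ i - 2 * pi * of_int (round (\<eta> $ i / (2 * pi)))\<bar> \<le> pi" for i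
  proof -
    have "\<bar>\<eta> $ i - 2 * pi * of_int (round (\<eta> $ i / (2 * pi)))\<bar>
        = 2 * pi * \<bar>of_int (round (\<eta> $ i / (2 * pi))) - \<eta> $ i / (2 * pi)\<bar>"
      by (subst abs_minus_commute) (simp add: abs_mult[of "2 * pi", simplified, symmetric] right_diff_distrib)
    also have "\<dots> \<le> 2 * pi * (1/2)"
      by (intro mult_left_mono of_int_round_abs_le) simp
    finally show ?thesis by simp
  qed
  then show ?thesis by (simp add: torus_cell_iff nearest_lattice_def lattice_pt_def abs_le_iff) (smt (verit))
qed

lemma finite_nearest_lattice:
  assumes "bounded S" shows "finite (nearest_lattice ` S)"
proof -
  obtain R where R: "\<And>\<eta>. \<eta> \<in> S \<Longrightarrow> norm \<eta> \<le> R" using assms by (auto simp: bounded_iff)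
  \<comment> \<open>Division by 2 pi does not increase the coordinates, and the extra 1 absorbs the
    rounding error of at most 1/2.\<close>
  define N where "N = \<lceil>R\<rceil> + 1"
  have "nearest_lattice ` S \<subseteq> vec_lambda ` (PiE UNIV (\<lambda>_. {-N..N}))"
  proof
    fix k assume "k \<in> nearest_lattice ` S"
    then obtain \<eta> where \<eta>: "\<eta> \<in> S" "k = nearest_lattice \<eta>" by blast
    have "k $ i \<in> {-N..N}" for i
    proof -
      have "\<bar>\<eta> $ i / (2 * pi)\<bar> \<le> \<bar>\<eta> $ i\<bar>"
        using pi_gt3 by (simp add: abs_divide divide_le_eq mult_le_cancel_left1)
      also have "\<dots> \<le> R" using component_le_norm_cart[of \<eta> i] R[OF \<eta>(1)] by linarith
      finally have "\<bar>\<eta> $ i / (2 * pi)\<bar> \<le> R" .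
      moreover have "\<bar>of_int (k $ i) - \<eta> $ i / (2 * pi)\<bar> \<le> 1/2"
        unfolding \<eta>(2) nearest_lattice_def vec_lambda_beta by (rule of_int_round_abs_le)
      moreover have "R + 1 \<le> of_int N" unfolding N_def by simp
      ultimately have "\<bar>of_int (k $ i)\<bar> \<le> real_of_int N" by linarith
      then show ?thesis by (simp add: abs_le_iff)
    qed
    then have "vec_nth k \<in> PiE UNIV (\<lambda>_. {-N..N})" by auto
    then show "k \<in> vec_lambda ` (PiE UNIV (\<lambda>_. {-N..N}))"
      by (metis imageI vec_nth_inverse)
  qed
  then show ?thesis by (rule finite_subset) (auto intro!: finite_PiE)
qed

text \<open>The image of a cell under \<open>M\<close> is covered by finitely many translates of the cell.\<close>

lemma nn_integral_period_cell_linear: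
  fixes M :: "real^'n^'n"
  assumes "invertible M"
  obtains C :: real where "C \<ge> 0"
    "\<And>g :: real^'n \<Rightarrow> ennreal. g \<in> borel_measurable borel \<Longrightarrow>
      (\<And>\<xi> k. g (\<xi> + (2 * pi) *\<^sub>R lattice_pt k) = g \<xi>) \<Longrightarrow>
      (\<integral>\<^sup>+\<xi>. g (M *v \<xi>) \<partial>period_cell) \<le> ennreal C * (\<integral>\<^sup>+\<xi>. g \<xi> \<partial>period_cell)"
proof -
  obtain M' where M': "M' ** M = Finite_Cartesian_Product.mat 1" "M ** M' = Finite_Cartesian_Product.mat 1"
    using assms by (auto simp: invertible_def)
  have MM': "M' *v (M *v x) = x" "M *v (M' *v x) = x" for x
    by (simp_all add: matrix_vector_mul_assoc M')
  obtain C where C: "C \<ge> 0" "\<And>f :: real^'n \<Rightarrow> ennreal. f \<in> borel_measurable borel \<Longrightarrow>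
      (\<integral>\<^sup>+x. f (M *v x) \<partial>lborel) = ennreal C * (\<integral>\<^sup>+x. f x \<partial>lborel)"
    by (rule nn_integral_lborel_linear[OF assms]) blast
  \<comment> \<open>Indices of the translated cells covering the image of the cell. Periodicity
    gives every translate the same integral, so their number becomes a factor of the
    constant.\<close>
  define F where "F = nearest_lattice ` ((\<lambda>x. M *v x) ` torus_cell)"
  have F: "finite F"
    unfolding F_def
    by (intro finite_nearest_lattice bounded_linear_image bounded_cbox matrix_vector_mul_bounded_linear)
  have "(\<integral>\<^sup>+\<xi>. g (M *v \<xi>) \<partial>period_cell) \<le> ennreal (C * card F) * (\<integral>\<^sup>+\<xi>. g \<xi> \<partial>period_cell)"
    if g [measurable]: "g \<in> borel_measurable borel"
      and per: "\<And>\<xi> k. g (\<xi> + (2 * pi) *\<^sub>R lattice_pt k) = g \<xi>" for g :: "real^'n \<Rightarrow> ennreal"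
  proof -
    have cell [measurable]: "torus_cell \<in> sets borel" by simp
    define G where "G \<eta> = g \<eta> * indicator torus_cell (M' *v \<eta>)" for \<eta>
    define H where "H \<eta> = g \<eta> * indicator torus_cell \<eta>" for \<eta>
    have H: "H \<in> borel_measurable borel" unfolding H_def by measurable
    have "(\<integral>\<^sup>+\<xi>. g (M *v \<xi>) \<partial>period_cell) = (\<integral>\<^sup>+\<xi>. G (M *v \<xi>) \<partial>lborel)"
      by (simp add: nn_integral_period_cell G_def MM')
    also have "\<dots> = ennreal C * (\<integral>\<^sup>+\<eta>. G \<eta> \<partial>lborel)"
      unfolding G_def
      by (intro C borel_measurable_times_ennreal g measurable_compose[OF matrix_vector_mult_measurable borel_measurable_indicator] cell)
    also have "(\<integral>\<^sup>+\<eta>. G \<eta> \<partial>lborel) \<le> (\<integral>\<^sup>+\<eta>. (\<Sum>k\<in>F. H (- ((2 * pi) *\<^sub>R lattice_pt k) + \<eta>)) \<partial>lborel)"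
    proof (rule nn_integral_mono)
      fix \<eta> :: "real^'n"
      show "G \<eta> \<le> (\<Sum>k\<in>F. H (- ((2 * pi) *\<^sub>R lattice_pt k) + \<eta>))"
      proof (cases "M' *v \<eta> \<in> torus_cell")
        case True
        let ?k = "nearest_lattice \<eta>"
        have "?k \<in> F" unfolding F_def using imageI[OF True, of "\<lambda>x. M *v x"] by (simp add: MM')
        have "G \<eta> = H (- ((2 * pi) *\<^sub>R lattice_pt ?k) + \<eta>)"
          using True nearest_lattice[of \<eta>] per[of "\<eta> - (2 * pi) *\<^sub>R lattice_pt ?k" ?k]
          by (simp add: G_def H_def)
        also have "\<dots> \<le> (\<Sum>k\<in>F. H (- ((2 * pi) *\<^sub>R lattice_pt k) + \<eta>))"
          by (rule member_le_sum[OF \<open>?k \<in> F\<close> _ F]) simp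
        finally show ?thesis .
      qed (simp add: G_def)
    qed
    also have "\<dots> = (\<Sum>k\<in>F. \<integral>\<^sup>+\<eta>. H (- ((2 * pi) *\<^sub>R lattice_pt k) + \<eta>) \<partial>lborel)"
      by (rule nn_integral_sum) (use H in measurable)
    also have "\<dots> = (\<Sum>k\<in>F. \<integral>\<^sup>+\<eta>. H \<eta> \<partial>lborel)"
      by (intro sum.cong refl nn_integral_lborel_translation H)
    also have "\<dots> = of_nat (card F) * (\<integral>\<^sup>+\<xi>. g \<xi> \<partial>period_cell)"
      by (simp add: nn_integral_period_cell H_def)
    finally show ?thesis
      using C(1) by (simp add: ennreal_mult mult.assoc mult_left_mono ennreal_of_nat_eq_real_of_nat)
  qed
  with C(1) show ?thesis by (intro that[of "C * card F"]) auto
qed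

text \<open>A periodic property failing on a null subset of the cell fails only on the countable
  union of the lattice translates of that subset.\<close>

lemma AE_period_cell_imp_AE_lborel:
  assumes P: "{\<xi>. P \<xi>} \<in> sets borel" and per: "\<And>\<xi> k. P (\<xi> + (2 * pi) *\<^sub>R lattice_pt k) = P \<xi>"
    and ae: "AE \<xi> in period_cell. P \<xi>"
  shows "AE \<xi> in (lborel :: (real^'n) measure). P \<xi>"
proof -
  let ?Q = "\<lambda>\<xi>. \<xi> \<in> torus_cell \<longrightarrow> P \<xi>"
  have Q: "{\<xi>. ?Q \<xi>} \<in> sets borel"
  proof -
    have "{\<xi>. ?Q \<xi>} = - torus_cell \<union> {\<xi>. P \<xi>}" by auto
    then show ?thesis using P by auto
  qed
  have "AE \<xi> in lborel. ?Q \<xi>"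
    using ae unfolding period_cell_def by (subst (asm) AE_restrict_space_iff) auto
  then have "AE \<xi> in distr lborel borel ((+) (- ((2 * pi) *\<^sub>R lattice_pt k))). ?Q \<xi>" for k :: "int^'n"
    by (simp only: lborel_distr_plus)
  then have "AE \<xi> in lborel. ?Q (- ((2 * pi) *\<^sub>R lattice_pt k) + \<xi>)" for k :: "int^'n"
    using Q by (subst (asm) AE_distr_iff) auto
  then have "AE \<xi> in lborel. \<forall>k. ?Q (- ((2 * pi) *\<^sub>R lattice_pt k) + \<xi>)"
    by (subst AE_all_countable) blast
  then show ?thesis
  proof eventually_elim
    case (elim \<xi>)
    let ?k = "nearest_lattice \<xi>"
    show ?case
      using elim[rule_format, of ?k] nearest_lattice[of \<xi>] per[of "\<xi> - (2 * pi) *\<^sub>R lattice_pt ?k" ?k]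
      by simp
  qed
qed

section \<open>Coefficients of orthogonal series\<close>

text \<open>Pairing the series with \<open>e l\<close> leaves a single nonzero term by
  orthogonality; continuity of the pairing makes this legitimate.\<close>

lemma L2_has_sum_coefficient:
  assumes sum: "L2_has_sum M (\<lambda>k x. a k * e k x) s"
    and e: "\<And>k. e k \<in> L2 M"
    and orth: "\<And>k l. L2_inner M (e k) (e l) = (if k = l then of_real N else 0)"
  shows "L2_inner M s (e l) = of_real N * a l"
proof -
  have "((\<lambda>k. L2_inner M (\<lambda>x. a k * e k x) (e l)) has_sum L2_inner M s (e l)) UNIV"
    by (rule L2_has_sum_inner[OF sum e])
  moreover have "((\<lambda>k. L2_inner M (\<lambda>x. a k * e k x) (e l)) has_sum of_real N * a l) UNIV"
  proof (rule has_sum_cong_neutral[THEN iffD1])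
    show "((\<lambda>k. L2_inner M (\<lambda>x. a k * e k x) (e l)) has_sum of_real N * a l) {l}"
      by (rule has_sum_finiteI) (simp_all add: L2_inner_cmult_left orth)
  qed (auto simp: L2_inner_cmult_left orth)
  ultimately show ?thesis by (rule has_sum_unique)
qed

text \<open>Expanding \<open>\<phi> (A' (B' x))\<close> in the translates of \<open>\<phi>\<close>, where \<open>A'\<close>, \<open>B'\<close> are inverses of
  \<open>A\<close>, \<open>B\<close>: first \<open>\<phi> \<circ> A'\<close>, then \<open>\<phi> (B' x - k) = (\<phi> \<circ> B') (x - B k)\<close>.\<close>

lemma composed_filter_coefficients:
  fixes \<phi> :: "real^'n \<Rightarrow> complex" and B' :: "real^'n^'n"
  defines "e \<equiv> \<lambda>(k::int^'n) x. \<phi> (x - lattice_pt k)"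
  assumes \<phi>: "\<And>k. e k \<in> L2 lborel"
    and orth: "\<And>k l. L2_inner lborel (e k) (e l) = (if k = l then 1 else 0)"
    and a: "L2_has_sum lborel (\<lambda>k x. a k * e k x) (\<lambda>x. \<phi> (A' *v x))"
    and b: "L2_has_sum lborel (\<lambda>k x. b k * e k x) (\<lambda>x. \<phi> (B' *v x))"
    and B': "B' ** B = Finite_Cartesian_Product.mat 1" "B ** B' = Finite_Cartesian_Product.mat 1"
    and \<mu>: "\<And>k. lattice_pt (\<mu> k) = B *v lattice_pt k"
  shows "((\<lambda>k. a k * b (n - \<mu> k)) has_sum L2_inner lborel (\<lambda>x. \<phi> (A' *v (B' *v x))) (e n)) UNIV"
proof -
  have "invertible B'" using B' by (auto simp: invertible_def)
  then obtain C where C: "\<And>f. f \<in> L2 lborel \<Longrightarrow> (\<lambda>x. f (B' *v x)) \<in> L2 lborel"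
    "\<And>f. f \<in> L2 lborel \<Longrightarrow> L2_norm lborel (\<lambda>x. f (B' *v x)) \<le> C * L2_norm lborel f"
    by (rule L2_norm_linear) blast
  have sA: "(\<lambda>x. \<phi> (A' *v x)) \<in> L2 lborel" and sB: "(\<lambda>x. \<phi> (B' *v x)) \<in> L2 lborel"
    using a b by (auto simp: L2_has_sum_def)
  \<comment> \<open>Composition with \<open>B'\<close> is bounded on square integrable functions, so
    the expansion of \<phi> (A' x) may be composed termwise.\<close>
  have "L2_has_sum lborel (\<lambda>k x. a k * e k (B' *v x)) (\<lambda>x. \<phi> (A' *v (B' *v x)))"
  proof (rule L2_has_sum_transfer[OF a, where C = C])
    show "(\<lambda>x. a k * e k (B' *v x)) \<in> L2 lborel" for k
      by (intro L2_cmult C \<phi>)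
    show "(\<lambda>x. \<phi> (A' *v (B' *v x))) \<in> L2 lborel" by (rule C(1)[OF sA])
    show "L2_norm lborel (\<lambda>x. (\<Sum>k\<in>K. a k * e k (B' *v x)) - \<phi> (A' *v (B' *v x)))
        \<le> C * L2_norm lborel (\<lambda>x. (\<Sum>k\<in>K. a k * e k x) - \<phi> (A' *v x))" for K
      by (rule C(2)[of "\<lambda>x. (\<Sum>k\<in>K. a k * e k x) - \<phi> (A' *v x)"])
        (intro L2_diff L2_sum L2_cmult \<phi> sA)
  qed
  from L2_has_sum_inner[OF this \<phi>[of n]]
  have "((\<lambda>k. a k * L2_inner lborel (\<lambda>x. e k (B' *v x)) (e n)) has_sum
      L2_inner lborel (\<lambda>x. \<phi> (A' *v (B' *v x))) (e n)) UNIV"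
    by (simp only: L2_inner_cmult_left)
  moreover have "L2_inner lborel (\<lambda>x. e k (B' *v x)) (e n) = b (n - \<mu> k)" for k
  proof -
    let ?f = "\<lambda>x. e k (B' *v x) * cnj (e n x)"
    have "integrable lborel ?f" by (intro L2_mult_integrable L2_cnj \<phi> C)
    then have meas: "?f \<in> borel_measurable borel" using borel_measurable_integrable by fastforce
    \<comment> \<open>Shifting x by B k removes k from the dilated factor and turns the translate by
      n into the translate by n - B k, so the pairing is a single coefficient of \<phi> (B'
      x).\<close>
    have "L2_inner lborel (\<lambda>x. e k (B' *v x)) (e n) = (LINT x|lborel. ?f (B *v lattice_pt k + x))"
      unfolding L2_inner_def by (rule integral_lborel_translation[OF meas, symmetric])
    also have "\<dots> = L2_inner lborel (\<lambda>x. \<phi> (B' *v x)) (e (n - \<mu> k))"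
      unfolding L2_inner_def
    proof (rule Bochner_Integration.integral_cong[OF refl])
      fix x
      have "B' *v (B *v lattice_pt k + x) - lattice_pt k = B' *v x"
        by (simp add: matrix_vector_right_distrib matrix_vector_mul_assoc B')
      moreover have "B *v lattice_pt k + x - lattice_pt n = x - lattice_pt (n - \<mu> k)"
        by (simp add: lattice_pt_diff \<mu>)
      ultimately show "?f (B *v lattice_pt k + x) = \<phi> (B' *v x) * cnj (e (n - \<mu> k) x)"
        by (simp only: e_def)
    qed
    also have "\<dots> = b (n - \<mu> k)"
      using L2_has_sum_coefficient[OF b \<phi>, of 1] orth by simp
    finally show ?thesis .
  qed
  ultimately show ?thesis by simp
qed

text \<open>Counterpart in \<xi> of the preceding computation: f (B \<xi>) is the sum of a k times
  the character of frequency B k, and integration of that character against g and the character of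
  frequency -n extracts b (n - B k). Only the series of f is summed; g contributes through
  orthogonality.\<close>

lemma filter_product_coefficients:
  fixes B :: "real^'n^'n" and f g :: "real^'n \<Rightarrow> complex"
  defines "N \<equiv> (2 * pi) ^ CARD('n)"
  assumes f: "f \<in> borel_measurable borel" "\<And>\<xi> k. f (\<xi> + (2 * pi) *\<^sub>R lattice_pt k) = f \<xi>"
    and a: "L2_has_sum period_cell (\<lambda>k \<xi>. a k * torus_char k \<xi>) f"
    and b: "L2_has_sum period_cell (\<lambda>k \<xi>. b k * torus_char k \<xi>) g"
    and B: "invertible B" "Finite_Cartesian_Product.transpose B = B"
    and \<mu>: "\<And>k. lattice_pt (\<mu> k) = B *v lattice_pt k"
  shows "integrable period_cell (\<lambda>\<xi>. f (B *v \<xi>) * g \<xi>)"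
    and "((\<lambda>k. of_real N * (a k * b (n - \<mu> k))) has_sum
      (LINT \<xi>|period_cell. f (B *v \<xi>) * g \<xi> * torus_char (- n) \<xi>)) UNIV"
proof -
  have fL2: "f \<in> L2 period_cell" and gL2: "g \<in> L2 period_cell"
    using a b by (auto simp: L2_has_sum_def)
  obtain C where C: "C \<ge> 0"
    "\<And>u :: real^'n \<Rightarrow> ennreal. u \<in> borel_measurable borel \<Longrightarrow>
      (\<And>\<xi> k. u (\<xi> + (2 * pi) *\<^sub>R lattice_pt k) = u \<xi>) \<Longrightarrow>
      (\<integral>\<^sup>+\<xi>. u (B *v \<xi>) \<partial>period_cell) \<le> ennreal C * (\<integral>\<^sup>+\<xi>. u \<xi> \<partial>period_cell)"
    by (rule nn_integral_period_cell_linear[OF B(1)]) blast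
  \<comment> \<open>Values of \<open>u\<close> outside the cell occur here, hence the hypotheses
    that \<open>u\<close> is Borel on the whole space and exactly periodic.\<close>
  have per: "(\<lambda>\<xi>. u (B *v \<xi>)) \<in> L2 period_cell \<and>
      L2_norm period_cell (\<lambda>\<xi>. u (B *v \<xi>)) \<le> sqrt C * L2_norm period_cell u"
    if u: "u \<in> L2 period_cell" "u \<in> borel_measurable borel"
      "\<And>\<xi> k. u (\<xi> + (2 * pi) *\<^sub>R lattice_pt k) = u \<xi>" for u :: "real^'n \<Rightarrow> complex"
  proof -
    note [measurable] = u(2)
    have 1: "(\<lambda>\<xi>. u (B *v \<xi>)) \<in> borel_measurable period_cell"
      by (rule period_cell_measurable) measurable
    have 2: "(\<integral>\<^sup>+\<xi>. ennreal ((cmod (u (B *v \<xi>)))\<^sup>2) \<partial>period_cell)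
        \<le> ennreal C * (\<integral>\<^sup>+\<xi>. ennreal ((cmod (u \<xi>))\<^sup>2) \<partial>period_cell)"
      by (rule C(2)[of "\<lambda>\<xi>. ennreal ((cmod (u \<xi>))\<^sup>2)"]) (measurable, simp add: u(3))
    show ?thesis using L2_norm_le_of_nn_integral[OF u(1) 1 C(1) 2] by blast
  qed
  have char: "torus_char k (B *v \<xi>) = torus_char (\<mu> k) \<xi>" for k \<xi>
    by (rule torus_char_matrix[OF B(2) \<mu>])
  have fB: "(\<lambda>\<xi>. f (B *v \<xi>)) \<in> L2 period_cell" using per[OF fL2 f] by blast
  then show "integrable period_cell (\<lambda>\<xi>. f (B *v \<xi>) * g \<xi>)"
    by (rule L2_mult_integrable) (rule gL2)
  have series: "L2_has_sum period_cell (\<lambda>k \<xi>. a k * torus_char (\<mu> k) \<xi>) (\<lambda>\<xi>. f (B *v \<xi>))"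
  proof (rule L2_has_sum_transfer[OF a _ fB, where C = "sqrt C"])
    show "(\<lambda>\<xi>. a k * torus_char (\<mu> k) \<xi>) \<in> L2 period_cell" for k
      by (intro L2_cmult L2_torus_char)
    fix K :: "(int^'n) set"
    let ?u = "\<lambda>\<xi>. (\<Sum>k\<in>K. a k * torus_char k \<xi>) - f \<xi>"
    have "?u \<in> L2 period_cell" by (intro L2_diff L2_sum L2_cmult L2_torus_char fL2)
    moreover have "?u \<in> borel_measurable borel"
      by (intro borel_measurable_diff borel_measurable_sum borel_measurable_times f(1)) simp_all
    moreover have "?u (\<xi> + (2 * pi) *\<^sub>R lattice_pt k) = ?u \<xi>" for \<xi> k
      by (simp only: f(2) torus_char_periodic)
    ultimately show "L2_norm period_cell (\<lambda>\<xi>. (\<Sum>k\<in>K. a k * torus_char (\<mu> k) \<xi>) - f (B *v \<xi>))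
        \<le> sqrt C * L2_norm period_cell ?u"
      using per[of ?u] by (simp only: char)
  qed
  \<comment> \<open>Chosen so that pairing with v means integrating against g times the character of
    frequency -n; the inner product conjugates its second argument.\<close>
  define v where "v = (\<lambda>\<xi>. cnj (g \<xi>) * torus_char n \<xi>)"
  have v: "v \<in> L2 period_cell"
    using L2_cnj[OF gL2] period_cell_measurable[OF torus_char_measurable[of n]]
    unfolding v_def L2_def by (auto simp: norm_mult intro!: borel_measurable_times)
  have "((\<lambda>k. a k * L2_inner period_cell (torus_char (\<mu> k)) v) has_sum
      L2_inner period_cell (\<lambda>\<xi>. f (B *v \<xi>)) v) UNIV"
    using L2_has_sum_inner[OF series v] by (simp only: L2_inner_cmult_left)
  moreover have "L2_inner period_cell (torus_char (\<mu> k)) v = of_real N * b (n - \<mu> k)" for k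
  proof -
    have "L2_inner period_cell (torus_char (\<mu> k)) v = L2_inner period_cell g (torus_char (n - \<mu> k))"
      unfolding L2_inner_def v_def
    proof (rule Bochner_Integration.integral_cong[OF refl])
      fix \<xi>
      have "torus_char (\<mu> k) \<xi> * torus_char (- n) \<xi> = torus_char (- (n - \<mu> k)) \<xi>"
        by (simp add: torus_char_mult)
      then show "torus_char (\<mu> k) \<xi> * cnj (cnj (g \<xi>) * torus_char n \<xi>) = g \<xi> * cnj (torus_char (n - \<mu> k) \<xi>)"
        by (simp only: cnj_torus_char complex_cnj_mult complex_cnj_cnj mult.left_commute)
    qed
    also have "\<dots> = of_real N * b (n - \<mu> k)"
      unfolding N_def by (rule L2_has_sum_coefficient[OF b L2_torus_char torus_char_orthogonal])
    finally show ?thesis .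
  qed
  moreover have "L2_inner period_cell (\<lambda>\<xi>. f (B *v \<xi>)) v
      = (LINT \<xi>|period_cell. f (B *v \<xi>) * g \<xi> * torus_char (- n) \<xi>)"
    by (simp add: L2_inner_def v_def cnj_torus_char mult.assoc)
  ultimately show "((\<lambda>k. of_real N * (a k * b (n - \<mu> k))) has_sum
      (LINT \<xi>|period_cell. f (B *v \<xi>) * g \<xi> * torus_char (- n) \<xi>)) UNIV"
    by (simp add: mult.left_commute)
qed

section \<open>Marginal filters of a biscaled multiresolution analysis\<close>

lemma matrix_inv_inverse:
  fixes T :: "real^'n^'n"
  assumes "invertible T"
  shows "T ** matrix_inv T = Finite_Cartesian_Product.mat 1"
    and "matrix_inv T ** T = Finite_Cartesian_Product.mat 1"
  using someI_ex[OF assms[unfolded invertible_def]] by (simp_all add: matrix_inv_def)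

text \<open>Negative powers in \<open>op_zpow\<close> are powers of \<open>inv_into UNIV\<close>, so
  bijectivity on all functions has to be used to identify the chosen preimage pointwise.\<close>

lemma inv_dilation:
  fixes T :: "real^'n^'n"
  assumes "invertible T"
  shows "inv_into UNIV (dilation T) f
    = (\<lambda>x. complex_of_real (1 / sqrt \<bar>Determinants.det T\<bar>) * f (matrix_inv T *v x))"
proof (rule inv_f_eq)
  have d: "complex_of_real (sqrt \<bar>Determinants.det T\<bar>) \<noteq> 0"
    using assms by (simp add: invertible_det_nz)
  have T: "T *v (matrix_inv T *v x) = x" "matrix_inv T *v (T *v x) = x" for x
    using matrix_inv_inverse[OF assms] by (simp_all add: matrix_vector_mul_assoc)
  show "inj (dilation T)"
  proof (rule injI, rule ext)
    fix g h :: "real^'n \<Rightarrow> complex" and x assume "dilation T g = dilation T h"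
    from fun_cong[OF this, of "matrix_inv T *v x"] show "g x = h x"
      using d by (simp add: dilation_def T)
  qed
  show "dilation T (\<lambda>x. complex_of_real (1 / sqrt \<bar>Determinants.det T\<bar>) * f (matrix_inv T *v x)) = f"
    using d by (simp add: dilation_def T)
qed

text \<open>The choice in the definition is meaningful once a witness exists; the inner products
  with the orthonormal basis provide one.\<close>

lemma filter_coeff:
  fixes T :: "real^'n^'n"
  assumes onb: "L2_orthonormal_basis lborel V (\<lambda>(k::int^'n) x. \<phi> (x - lattice_pt k))"
    and V: "(\<lambda>x. \<phi> (matrix_inv T *v x)) \<in> V"
  shows "(\<lambda>k. (cmod (filter_coeff T \<phi> k))\<^sup>2) summable_on UNIV \<and>
    L2_has_sum lborel (\<lambda>k x. filter_coeff T \<phi> k * \<phi> (x - lattice_pt k)) (\<lambda>x. \<phi> (matrix_inv T *v x))"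
proof -
  let ?P = "\<lambda>c. (\<lambda>k. (cmod (c k))\<^sup>2) summable_on UNIV \<and>
    L2_has_sum lborel (\<lambda>k x. c k * \<phi> (x - lattice_pt k)) (\<lambda>x. \<phi> (matrix_inv T *v x))"
  have "?P (\<lambda>k. L2_inner lborel (\<lambda>x. \<phi> (matrix_inv T *v x)) (\<lambda>x. \<phi> (x - lattice_pt k)))"
    by (intro conjI Bessel_summable[OF onb V] L2_orthonormal_expansion[OF onb V])
  then have "?P (SOME c. ?P c)" by (rule someI[where P = ?P])
  then show ?thesis unfolding filter_coeff_def .
qed

text \<open>Riesz-Fischer supplies the witness for the choice. Its pointwise limit of trigonometric
  polynomials is Borel on the whole space and periodic at every point, because each partial sum
  is.\<close>

lemma marginal_filter:
  fixes T :: "real^'n^'n"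
  assumes "(\<lambda>k. (cmod (filter_coeff T \<phi> k))\<^sup>2) summable_on UNIV"
  shows "marginal_filter T \<phi> \<in> borel_measurable borel \<and>
    (\<forall>\<xi> k. marginal_filter T \<phi> (\<xi> + (2 * pi) *\<^sub>R lattice_pt k) = marginal_filter T \<phi> \<xi>) \<and>
    L2_has_sum period_cell
      (\<lambda>k \<xi>. complex_of_real (1 / \<bar>Determinants.det T\<bar>) * filter_coeff T \<phi> k * torus_char k \<xi>)
      (marginal_filter T \<phi>)"
proof -
  let ?a = "\<lambda>k. complex_of_real (1 / \<bar>Determinants.det T\<bar>) * filter_coeff T \<phi> k"
  let ?P = "\<lambda>m. m \<in> borel_measurable borel \<and>
    (\<forall>\<xi> k. m (\<xi> + (2 * pi) *\<^sub>R lattice_pt k) = m \<xi>) \<and>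
    L2_has_sum period_cell (\<lambda>k \<xi>. ?a k * torus_char k \<xi>) m"
  have a: "(\<lambda>k. (cmod (?a k))\<^sup>2) summable_on UNIV"
    using summable_on_cmult_right[OF assms] by (simp only: norm_mult power_mult_distrib)
  obtain K :: "nat \<Rightarrow> (int^'n) set" where
    K: "L2_has_sum period_cell (\<lambda>k \<xi>. ?a k * torus_char k \<xi>) (\<lambda>\<xi>. lim (\<lambda>j. \<Sum>k\<in>K j. ?a k * torus_char k \<xi>))"
    by (rule finite_measure.Riesz_Fischer[OF finite_measure_period_cell L2_torus_char torus_char_orthogonal a])
  have "(\<lambda>\<xi>. lim (\<lambda>j. \<Sum>k\<in>K j. ?a k * torus_char k \<xi>)) \<in> borel_measurable borel"
    by (intro borel_measurable_lim_metric borel_measurable_sum borel_measurable_times) simp_all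
  moreover have "lim (\<lambda>j. \<Sum>k\<in>K j. ?a k * torus_char k (\<xi> + (2 * pi) *\<^sub>R lattice_pt l))
      = lim (\<lambda>j. \<Sum>k\<in>K j. ?a k * torus_char k \<xi>)" for \<xi> l
    by (simp only: torus_char_periodic)
  moreover note K
  ultimately have "?P (\<lambda>\<xi>. lim (\<lambda>j. \<Sum>k\<in>K j. ?a k * torus_char k \<xi>))"
    by (intro conjI allI)
  then have "?P (SOME m. ?P m)" by (rule someI[where P = ?P])
  then show ?thesis unfolding marginal_filter_def torus_char_def .
qed

text \<open>Up to a scalar, \<phi> composed with the inverse of A is the inverse dilation of \<phi>.
  It lies in \<open>V (-1) 0\<close>, which is contained in \<open>V 0 0\<close>; similarly for B
  and \<open>V 0 (-1)\<close>.\<close>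

lemma bmra_refinable:
  fixes A B :: "real^'n^'n"
  assumes pair: "commuting_dilation_pair A B" and bmra: "bmra A B \<phi> V"
  shows "(\<lambda>x. \<phi> (matrix_inv A *v x)) \<in> V 0 0" "(\<lambda>x. \<phi> (matrix_inv B *v x)) \<in> V 0 0"
proof -
  have onb: "L2_orthonormal_basis lborel (V 0 0) (\<lambda>(k::int^'n) x. \<phi> (x - lattice_pt k))"
    and sub: "\<forall>i j. L2_closed_subspace lborel (V i j)"
    and mono: "\<forall>i j l m. i \<le> l \<longrightarrow> j \<le> m \<longrightarrow> V i j \<subseteq> V l m"
    and dil: "\<forall>i j. (op_zpow (dilation A) i \<circ> op_zpow (dilation B) j) ` V 0 0 = V i j"
    using bmra unfolding bmra_def by - (elim conjE, assumption)+
  have \<phi>: "\<phi> \<in> V 0 0"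
  proof -
    let ?e = "\<lambda>(k::int^'n) x. \<phi> (x - lattice_pt k)"
    have e: "?e k \<in> L2 lborel" for k using onb unfolding L2_orthonormal_basis_def by blast
    have \<phi>e: "\<phi> = ?e 0" by (simp add: lattice_pt_zero)
    have "?e 0 \<in> lin_span ?e"
      unfolding lin_span_def by (auto intro!: exI[of _ "{0}"] exI[of _ "\<lambda>_. 1"])
    then have "\<phi> \<in> L2_closure lborel (lin_span ?e)"
      using e[of 0] unfolding \<phi>e[symmetric] L2_closure_def
      by (auto simp: L2_norm_def intro!: bexI[of _ \<phi>])
    then show ?thesis using onb by (simp add: L2_orthonormal_basis_def)
  qed
  have scaled: "\<forall>f\<in>V 0 0. \<forall>a. (\<lambda>x. a * f x) \<in> V 0 0"
    using sub[rule_format, of 0 0] unfolding L2_closed_subspace_def by - (elim conjE, assumption)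
  have scale: "(\<lambda>x. \<phi> (matrix_inv T *v x)) \<in> V 0 0"
    if T: "invertible T" "inv_into UNIV (dilation T) \<phi> \<in> V 0 0" for T :: "real^'n^'n"
  proof -
    have d: "complex_of_real (sqrt \<bar>Determinants.det T\<bar>) \<noteq> 0"
      using T(1) by (simp add: invertible_det_nz)
    \<comment> \<open>Multiplication by the square root of |det T| cancels the normalization of the
      inverse dilation.\<close>
    have "(\<lambda>x. complex_of_real (sqrt \<bar>Determinants.det T\<bar>) * inv_into UNIV (dilation T) \<phi> x) \<in> V 0 0"
      by (rule scaled[rule_format, OF T(2)])
    then show ?thesis using d by (simp add: inv_dilation[OF T(1)])
  qed
  have "(op_zpow (dilation A) (- 1) \<circ> op_zpow (dilation B) 0) \<phi> \<in> V 0 0"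
    using imageI[OF \<phi>, of "op_zpow (dilation A) (- 1) \<circ> op_zpow (dilation B) 0"]
    unfolding dil[rule_format] by (rule subsetD[OF mono[rule_format], rotated 2]) simp_all
  then show "(\<lambda>x. \<phi> (matrix_inv A *v x)) \<in> V 0 0"
    by (intro scale commuting_dilation_pair_properties[OF pair]) (simp add: op_zpow_def)
  have "(op_zpow (dilation A) 0 \<circ> op_zpow (dilation B) (- 1)) \<phi> \<in> V 0 0"
    using imageI[OF \<phi>, of "op_zpow (dilation A) 0 \<circ> op_zpow (dilation B) (- 1)"]
    unfolding dil[rule_format] by (rule subsetD[OF mono[rule_format], rotated 2]) simp_all
  then show "(\<lambda>x. \<phi> (matrix_inv B *v x)) \<in> V 0 0"
    by (intro scale commuting_dilation_pair_properties[OF pair]) (simp add: op_zpow_def)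
qed

theorem mainTheorem7:
  fixes A B :: "real^'n^'n"
    and \<phi> :: "real^'n \<Rightarrow> complex"
    and V :: "int \<Rightarrow> int \<Rightarrow> (real^'n \<Rightarrow> complex) set"
  assumes "commuting_dilation_pair A B"
    and "Finite_Cartesian_Product.transpose A = A"
    and "Finite_Cartesian_Product.transpose B = B"
    and "bmra A B \<phi> V"
    and "AE \<xi> in lborel. L2_fourier \<phi> \<xi> \<noteq> 0"
  shows "AE \<xi> in lborel.
    marginal_filter A \<phi> (B *v \<xi>) * marginal_filter B \<phi> \<xi> =
    marginal_filter A \<phi> \<xi> * marginal_filter B \<phi> (A *v \<xi>)"
proof -
  note pair = commuting_dilation_pair_properties[OF assms(1)]
  let ?e = "\<lambda>(k::int^'n) x. \<phi> (x - lattice_pt k)"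
  let ?mA = "marginal_filter A \<phi>" and ?mB = "marginal_filter B \<phi>"
  define dA where "dA = complex_of_real (1 / \<bar>Determinants.det A\<bar>)"
  define dB where "dB = complex_of_real (1 / \<bar>Determinants.det B\<bar>)"
  define a where "a = filter_coeff A \<phi>"
  define b where "b = filter_coeff B \<phi>"
  have onb: "L2_orthonormal_basis lborel (V 0 0) ?e"
    using assms(4) by (simp add: bmra_def)
  then have e: "\<And>k. ?e k \<in> L2 lborel"
    and orth: "\<And>k l. L2_inner lborel (?e k) (?e l) = (if k = l then 1 else 0)"
    by (auto simp: L2_orthonormal_basis_def)
  note fA = filter_coeff[OF onb bmra_refinable(1)[OF assms(1,4)]]
  note fB = filter_coeff[OF onb bmra_refinable(2)[OF assms(1,4)]]
  have mA: "?mA \<in> borel_measurable borel" "\<And>\<xi> k. ?mA (\<xi> + (2 * pi) *\<^sub>R lattice_pt k) = ?mA \<xi>"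
    "L2_has_sum period_cell (\<lambda>k \<xi>. dA * a k * torus_char k \<xi>) ?mA"
    using marginal_filter[OF conjunct1[OF fA]] by (auto simp: dA_def a_def)
  have mB: "?mB \<in> borel_measurable borel" "\<And>\<xi> k. ?mB (\<xi> + (2 * pi) *\<^sub>R lattice_pt k) = ?mB \<xi>"
    "L2_has_sum period_cell (\<lambda>k \<xi>. dB * b k * torus_char k \<xi>) ?mB"
    using marginal_filter[OF conjunct1[OF fB]] by (auto simp: dB_def b_def)
  obtain \<alpha> where \<alpha>: "\<And>k. lattice_pt (\<alpha> k) = A *v lattice_pt k"
    by (rule int_matrix_lattice_pt[of A]) (use pair in auto)
  obtain \<beta> where \<beta>: "\<And>k. lattice_pt (\<beta> k) = B *v lattice_pt k"
    by (rule int_matrix_lattice_pt[of B]) (use pair in auto)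
  note iA = matrix_inv_inverse[OF pair(1)] and iB = matrix_inv_inverse[OF pair(2)]
  have inv_commute: "matrix_inv A *v (matrix_inv B *v x) = matrix_inv B *v (matrix_inv A *v x)" for x
  proof -
    have BA: "B *v (A *v y) = A *v (B *v y)" for y
      by (simp add: matrix_vector_mul_assoc pair(3))
    have A: "A *v (matrix_inv A *v y) = y" "matrix_inv A *v (A *v y) = y" for y
      using iA by (simp_all add: matrix_vector_mul_assoc)
    have B: "B *v (matrix_inv B *v y) = y" "matrix_inv B *v (B *v y) = y" for y
      using iB by (simp_all add: matrix_vector_mul_assoc)
    show ?thesis by (metis A B BA)
  qed
  \<comment> \<open>Both sums are the n-th coefficient of the same function, by commutation of the
    inverses.\<close>
  have coeff: "infsum (\<lambda>k. a k * b (n - \<beta> k)) UNIV = infsum (\<lambda>k. b k * a (n - \<alpha> k)) UNIV" for n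
  proof -
    have "((\<lambda>k. a k * b (n - \<beta> k)) has_sum L2_inner lborel (\<lambda>x. \<phi> (matrix_inv A *v (matrix_inv B *v x))) (?e n)) UNIV"
      by (rule composed_filter_coefficients[OF e orth _ _ iB(2,1) \<beta>]) (use fA fB in \<open>simp_all add: a_def b_def\<close>)
    moreover have "((\<lambda>k. b k * a (n - \<alpha> k)) has_sum L2_inner lborel (\<lambda>x. \<phi> (matrix_inv B *v (matrix_inv A *v x))) (?e n)) UNIV"
      by (rule composed_filter_coefficients[OF e orth _ _ iA(2,1) \<alpha>]) (use fA fB in \<open>simp_all add: a_def b_def\<close>)
    ultimately show ?thesis by (simp add: inv_commute infsumI)
  qed
  \<comment> \<open>The factors of the second product are listed so that it is the first with A and
    B exchanged, and one lemma serves both.\<close>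
  let ?h = "\<lambda>\<xi>. ?mA (B *v \<xi>) * ?mB \<xi> - ?mB (A *v \<xi>) * ?mA \<xi>"
  note AB = filter_product_coefficients[OF mA mB(3) pair(2) assms(3) \<beta>]
  note BA = filter_product_coefficients[OF mB mA(3) pair(1) assms(2) \<alpha>]
  define N where "N = complex_of_real ((2 * pi) ^ CARD('n))"
  have "(LINT \<xi>|period_cell. ?h \<xi> * torus_char k \<xi>) = 0" for k
  proof -
    \<comment> \<open>The coefficient lemma integrates against the character of frequency -n, so n =
      - k is inserted.\<close>
    have I1: "(LINT \<xi>|period_cell. ?mA (B *v \<xi>) * ?mB \<xi> * torus_char k \<xi>)
        = N * dA * dB * infsum (\<lambda>l. a l * b (- k - \<beta> l)) UNIV"
      using infsumI[OF AB(2)[of "- k"]] unfolding N_def[symmetric]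
      by (subst infsum_cmult_right'[symmetric]) (simp add: ac_simps)
    have I2: "(LINT \<xi>|period_cell. ?mB (A *v \<xi>) * ?mA \<xi> * torus_char k \<xi>)
        = N * dA * dB * infsum (\<lambda>l. b l * a (- k - \<alpha> l)) UNIV"
      using infsumI[OF BA(2)[of "- k"]] unfolding N_def[symmetric]
      by (subst infsum_cmult_right'[symmetric]) (simp add: ac_simps)
    have i: "integrable period_cell (\<lambda>\<xi>. g \<xi> * torus_char k \<xi>)" if "integrable period_cell g" for g
      by (rule Bochner_Integration.integrable_bound[OF that])
        (use that period_cell_measurable[OF torus_char_measurable[of k]] in \<open>auto simp: norm_mult intro!: borel_measurable_times\<close>)
    show ?thesis
      unfolding left_diff_distrib Bochner_Integration.integral_diff[OF i[OF AB(1)] i[OF BA(1)]] I1 I2 coeff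
      by simp
  qed
  then have "AE \<xi> in period_cell. ?h \<xi> = 0"
    by (intro Fourier_coefficients_unique Bochner_Integration.integrable_diff AB(1) BA(1))
  then have "AE \<xi> in lborel. ?h \<xi> = 0"
  proof (rule AE_period_cell_imp_AE_lborel[rotated 2])
    note [measurable] = mA(1) mB(1)
    show "{\<xi>. ?h \<xi> = 0} \<in> sets borel" by measurable
    \<comment> \<open>A and B map the lattice into itself, so the composed filters keep the period
      lattice.\<close>
    show "(?h (\<xi> + (2 * pi) *\<^sub>R lattice_pt k) = 0) = (?h \<xi> = 0)" for \<xi> k
      by (simp add: matrix_vector_right_distrib matrix_vector_mult_scaleR \<alpha>[symmetric] \<beta>[symmetric] mA(2) mB(2))
  qed
  then show ?thesis by eventually_elim (simp add: mult.commute)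
qed

end
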